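(* Let $U,X,Z$ be finite-dimensional inner product spaces, let $A\in\mathcal{L}(X)$ and $B\in\mathcal{L}(U,X)$ be linear maps, let $f\colon X\to X$ be of the form $f(x)=\Gamma(x,x)$ for a symmetric bilinear map $\Gamma\colon X\times X\to X$, let $\widetilde{\Gamma}\colon Z\times X\to Z$ be bilinear, and let $F\colon Z\to Z$ be locally Lipschitz continuous. Let $\tau>0$, $x_0\in X$, $z_0\in Z$. Assume that $(\overline{z},\overline{x})\in W^{1,2}((0,\tau);Z)\times C([0,\tau];X)$ with initial values $(\overline{z}(0),\overline{x}(0))=(z_0,x_0)$ satisfies on $[0,\tau]$ the equation $$\dot{\overline{z}}(t)+\widetilde{\Gamma}(\overline{z}(t),\overline{x}(t))+F(\overline{z}(t))=0 .$$ Define recursively $E_0:=\operatorname{Range}(B)$ and $E_i:=\mathscr{F}(E_{i-1})$ for $i\geq1$ (with $\mathscr{F}$ as defined in the context), and suppose that there exists $n_X\in\mathbb{N}$ with $E_{n_X}=X$. Then, for any $\varepsilon>0$, there exists a control $u\in C^\infty([0,\tau];U)$ such that the solution $(x,z)$ to the coupled system $$\begin{cases}\dot{x}(t)+Ax(t)+f(x(t))=Bu(t),\\ \dot{z}(t)+\widetilde{\Gamma}(z(t),x(t))+F(z(t))=0,\\ x(0)=x_0,\quad z(0)=z_0,\end{cases}$$ (exists on $[0,\tau]$ and) obeys $$\sup_{t\in[0,\tau]}|z(t)-\overline{z}(t)|+|x(\tau)-\overline{x}(\tau)|+|||x-\overline{x}|||_\tau<\varepsilon .$$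
   Context: $|\cdot|$ denotes the norm of the respective space. For $\tau>0$ and $v\in L^1([0,\tau];X)$, the relaxation norm is $$|||v|||_\tau:=\sup_{t\in[0,\tau]}\left\|\int_0^t v(s)\,\mathrm{d}s\right\|_X .$$ Given a subspace $E\subset X$, $\mathscr{F}(E)$ denotes the largest subspace of $X$ such that every $\gamma\in\mathscr{F}(E)$ can be expressed as $\gamma=\xi_0-\sum_{i=1}^p f(\xi_i)$ for some $p\in\mathbb{N}$ and $\xi_0,\xi_1,\dots,\xi_p\in E$. *)

theory Defs
  imports "HOL-Analysis.Analysis"
begin

definition saturation_cone :: "('x::real_vector \<Rightarrow> 'x) \<Rightarrow> 'x set \<Rightarrow> 'x set" where
  "saturation_cone f E =
     {\<xi> 0 - (\<Sum>i=1..p. f (\<xi> i)) | (p::nat) (\<xi> :: nat \<Rightarrow> 'x). \<forall>i\<le>p. \<xi> i \<in> E}"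

text \<open>The largest linear subspace, with respect to inclusion, all of whose elements are of
  the form \<open>\<xi> 0 - (f (\<xi> 1) + \<dots> + f (\<xi> p))\<close> with \<open>\<xi> i \<in> E\<close>. For subspaces \<open>E\<close> and
  quadratic \<open>f\<close> it exists, see \<open>saturate_greatest\<close> below.\<close>

definition saturate :: "('x::real_vector \<Rightarrow> 'x) \<Rightarrow> 'x set \<Rightarrow> 'x set" where
  "saturate f E = (GREATEST V. subspace V \<and> V \<subseteq> saturation_cone f E)"

primrec saturating_space ::
    "('x::real_vector \<Rightarrow> 'x) \<Rightarrow> ('u \<Rightarrow> 'x) \<Rightarrow> nat \<Rightarrow> 'x set" where
  "saturating_space f B 0 = range B"
| "saturating_space f B (Suc i) = saturate f (saturating_space f B i)"

lemma saturation_cone_add: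
  assumes E: "subspace E" and a: "a \<in> saturation_cone f E" and b: "b \<in> saturation_cone f E"
  shows "a + b \<in> saturation_cone f E"
proof -
  obtain p :: nat and \<xi> where 1: "a = \<xi> 0 - (\<Sum>i=1..p. f (\<xi> i))" "\<forall>i\<le>p. \<xi> i \<in> E"
    using a unfolding saturation_cone_def by blast
  obtain q :: nat and \<eta> where 2: "b = \<eta> 0 - (\<Sum>i=1..q. f (\<eta> i))" "\<forall>i\<le>q. \<eta> i \<in> E"
    using b unfolding saturation_cone_def by blast
  define \<zeta> where "\<zeta> i = (if i = 0 then \<xi> 0 + \<eta> 0 else if i \<le> p then \<xi> i else \<eta> (i - p))" for i
  have "(\<Sum>i=1..p+q. f (\<zeta> i)) = (\<Sum>i=1..p. f (\<zeta> i)) + (\<Sum>i=p+1..p+q. f (\<zeta> i))"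
    by (rule sum.ub_add_nat) simp
  also have "(\<Sum>i=1..p. f (\<zeta> i)) = (\<Sum>i=1..p. f (\<xi> i))"
    by (intro sum.cong) (auto simp: \<zeta>_def)
  also have "(\<Sum>i=p+1..p+q. f (\<zeta> i)) = (\<Sum>i=1..q. f (\<zeta> (i + p)))"
    using sum.shift_bounds_cl_nat_ivl[of "\<lambda>i. f (\<zeta> i)" 1 p q] by (simp add: add.commute)
  also have "\<dots> = (\<Sum>i=1..q. f (\<eta> i))"
    by (intro sum.cong) (auto simp: \<zeta>_def)
  finally have "a + b = \<zeta> 0 - (\<Sum>i=1..p+q. f (\<zeta> i))"
    by (simp add: 1 2 \<zeta>_def)
  moreover have "\<forall>i\<le>p+q. \<zeta> i \<in> E"
    using 1 2 E by (auto simp: \<zeta>_def subspace_add)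
  ultimately show ?thesis
    unfolding saturation_cone_def by blast
qed

lemma saturation_cone_scale:
  assumes E: "subspace E" and "bilinear \<Gamma>" and f: "\<And>x. f x = \<Gamma> x x"
    and c: "c \<ge> 0" and a: "a \<in> saturation_cone f E"
  shows "c *\<^sub>R a \<in> saturation_cone f E"
proof -
  obtain p :: nat and \<xi> where 1: "a = \<xi> 0 - (\<Sum>i=1..p. f (\<xi> i))" "\<forall>i\<le>p. \<xi> i \<in> E"
    using a unfolding saturation_cone_def by blast
  define \<zeta> where "\<zeta> i = (if i = 0 then c *\<^sub>R \<xi> 0 else sqrt c *\<^sub>R \<xi> i)" for i :: nat
  have fs: "f (sqrt c *\<^sub>R x) = c *\<^sub>R f x" for x
    using c by (simp add: f bilinear_lmul[OF assms(2)] bilinear_rmul[OF assms(2)])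
  have "(\<Sum>i=1..p. f (\<zeta> i)) = (\<Sum>i=1..p. c *\<^sub>R f (\<xi> i))"
    by (intro sum.cong) (auto simp: \<zeta>_def fs)
  then have "c *\<^sub>R a = \<zeta> 0 - (\<Sum>i=1..p. f (\<zeta> i))"
    by (simp add: 1 \<zeta>_def scaleR_diff_right scaleR_sum_right)
  moreover have "\<forall>i\<le>p. \<zeta> i \<in> E"
    using 1 E by (auto simp: \<zeta>_def subspace_scale)
  ultimately show ?thesis
    unfolding saturation_cone_def by blast
qed

lemma saturate_greatest:
  assumes E: "subspace E" and "bilinear \<Gamma>" and f: "\<And>x. f x = \<Gamma> x x"
  shows saturate_eq: "saturate f E = {\<gamma>. \<gamma> \<in> saturation_cone f E \<and> - \<gamma> \<in> saturation_cone f E}"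
    and subspace_saturate: "subspace (saturate f E)"
    and saturate_subset: "saturate f E \<subseteq> saturation_cone f E"
    and saturate_maximal:
      "\<And>V. subspace V \<Longrightarrow> V \<subseteq> saturation_cone f E \<Longrightarrow> V \<subseteq> saturate f E"
proof -
  let ?S = "saturation_cone f E" let ?V = "{\<gamma>. \<gamma> \<in> ?S \<and> - \<gamma> \<in> ?S}"
  note sc = saturation_cone_scale[OF assms(1,2) f]
  have "0 \<in> E" using E by (rule subspace_0)
  then have 0: "0 \<in> ?S"
    unfolding saturation_cone_def
    by (intro CollectI exI[of _ "0::nat"] exI[of _ "\<lambda>_::nat. 0"]) simp
  have V: "subspace ?V"
  proof (rule subspaceI)
    show "0 \<in> ?V" using 0 by simp
    show "x + y \<in> ?V" if "x \<in> ?V" "y \<in> ?V" for x y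
      using that saturation_cone_add[OF E, of x f y] saturation_cone_add[OF E, of "- x" f "- y"] by simp
    show "c *\<^sub>R x \<in> ?V" if "x \<in> ?V" for c x
      using that sc[of c x] sc[of c "- x"] sc[of "- c" x] sc[of "- c" "- x"]
      by (cases "c \<ge> 0") auto
  qed
  have max: "V \<subseteq> ?V" if "subspace V" "V \<subseteq> ?S" for V
    using that by (auto dest: subspace_neg)
  show eq: "saturate f E = ?V"
    unfolding saturate_def by (rule Greatest_equality) (use V max in auto)
  show "subspace (saturate f E)" "saturate f E \<subseteq> ?S" using V by (auto simp: eq)
  show "\<And>V. subspace V \<Longrightarrow> V \<subseteq> ?S \<Longrightarrow> V \<subseteq> saturate f E" using max by (simp add: eq)
qed

text \<open>At a boundary point of an interval \<open>S\<close> the derivatives are one-sided.\<close>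

definition C_infinity_on :: "real set \<Rightarrow> (real \<Rightarrow> 'a::real_normed_vector) \<Rightarrow> bool" where
  "C_infinity_on S u \<longleftrightarrow>
     (\<exists>D :: nat \<Rightarrow> real \<Rightarrow> 'a. D 0 = u \<and>
        (\<forall>n. \<forall>t\<in>S. (D n has_vector_derivative D (Suc n) t) (at t within S)))"

definition test_function :: "real \<Rightarrow> (real \<Rightarrow> real) \<Rightarrow> bool" where
  "test_function \<tau> \<phi> \<longleftrightarrow> C_infinity_on UNIV \<phi> \<and>
     (\<exists>a b. 0 < a \<and> b < \<tau> \<and> (\<forall>t. t \<notin> {a..b} \<longrightarrow> \<phi> t = 0))"

definition square_integrable :: "real \<Rightarrow> (real \<Rightarrow> 'a::euclidean_space) \<Rightarrow> bool" where
  "square_integrable \<tau> v \<longleftrightarrow>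
     v \<in> borel_measurable (lebesgue_on {0<..<\<tau>}) \<and>
     integrable (lebesgue_on {0<..<\<tau>}) (\<lambda>t. (norm (v t))\<^sup>2)"

text \<open>Local integrability has to be required: the Bochner integral of a non-integrable function
  is \<open>0\<close> by convention, so the integral identity alone would not be meaningful.\<close>

definition has_weak_derivative ::
    "real \<Rightarrow> (real \<Rightarrow> 'a::euclidean_space) \<Rightarrow> (real \<Rightarrow> 'a) \<Rightarrow> bool" where
  "has_weak_derivative \<tau> v g \<longleftrightarrow>
     (\<forall>a b. 0 < a \<longrightarrow> b < \<tau> \<longrightarrow>
        v absolutely_integrable_on {a..b} \<and> g absolutely_integrable_on {a..b}) \<and>
     (\<forall>\<phi>. test_function \<tau> \<phi> \<longrightarrow>
        (LINT t|lebesgue_on {0<..<\<tau>}. deriv \<phi> t *\<^sub>R v t) =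
        - (LINT t|lebesgue_on {0<..<\<tau>}. \<phi> t *\<^sub>R g t))"

text \<open>The Sobolev space \<open>W\<^sup>1\<^sup>,\<^sup>2((0,\<tau>);Z)\<close>. Membership does not depend on the representative of an
  almost-everywhere class; where point values are used, the continuous one has to be chosen.\<close>

definition sobolev_W12 :: "real \<Rightarrow> (real \<Rightarrow> 'a::euclidean_space) \<Rightarrow> bool" where
  "sobolev_W12 \<tau> v \<longleftrightarrow> square_integrable \<tau> v \<and>
     (\<exists>g. square_integrable \<tau> g \<and> has_weak_derivative \<tau> v g)"

definition relaxation_norm :: "real \<Rightarrow> (real \<Rightarrow> 'a::euclidean_space) \<Rightarrow> real" where
  "relaxation_norm \<tau> v = (SUP t\<in>{0..\<tau>}. norm (integral {0..t} v))"

text \<open>Classical solutions on \<open>[0,\<tau>]\<close> of \<open>x' + A x + f x = B u\<close>, \<open>z' + \<Gamma>' z x + F z = 0\<close>.\<close>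

definition solves_coupled_system ::
    "real \<Rightarrow> ('x::euclidean_space \<Rightarrow> 'x) \<Rightarrow> ('x \<Rightarrow> 'x) \<Rightarrow> ('u \<Rightarrow> 'x)
      \<Rightarrow> ('z::euclidean_space \<Rightarrow> 'x \<Rightarrow> 'z) \<Rightarrow> ('z \<Rightarrow> 'z) \<Rightarrow> 'x \<Rightarrow> 'z \<Rightarrow> (real \<Rightarrow> 'u)
      \<Rightarrow> (real \<Rightarrow> 'x) \<Rightarrow> (real \<Rightarrow> 'z) \<Rightarrow> bool" where
  "solves_coupled_system \<tau> A f B \<Gamma>' F x0 z0 u x z \<longleftrightarrow>
     x 0 = x0 \<and> z 0 = z0 \<and>
     (\<forall>t\<in>{0..\<tau>}.
        (x has_vector_derivative (B (u t) - A (x t) - f (x t))) (at t within {0..\<tau>}) \<and>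
        (z has_vector_derivative (- \<Gamma>' (z t) (x t) - F (z t))) (at t within {0..\<tau>}))"

end

theory Submission
  imports Defs
begin

text \<open>
  Call \<open>(x, z)\<close> a trajectory with forcing \<open>g\<close> if \<open>x' + A x + f x = g\<close> and the equation for \<open>z\<close> hold.
  Since the last space \<open>E\<^sub>n\<close> is all of \<open>X\<close>, any smooth \<open>x\<close> is the first component of a trajectory with
  an \<open>E\<^sub>n\<close>-valued forcing, namely \<open>x' + A x + f x\<close>; taking for \<open>x\<close> a polynomial close to the target gives
  a trajectory near the target (\<open>smooth_trajectory_near_target\<close>). It remains to exchange an
  \<open>E\<^sub>i\<^sub>+\<^sub>1\<close>-valued smooth forcing for an \<open>E\<^sub>i\<close>-valued one, until the values lie in the range of \<open>B\<close>,
  moving the trajectory at each exchange by as little as desired in the sense of the theorem.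

  An \<open>E\<^sub>i\<^sub>+\<^sub>1\<close>-valued smooth forcing has the form \<open>\<eta> - f \<xi>\<^sub>1 - \<dots> - f \<xi>\<^sub>p\<close> with smooth \<open>E\<^sub>i\<close>-valued
  curves: a basis vector \<open>e\<close> and its opposite are both of the form \<open>\<xi>\<^sub>0 - \<Sum> f \<xi>\<^sub>j\<close>, a smooth coefficient is
  a difference of squares, \<open>a = ((a + 1) / 2)\<^sup>2 - ((a - 1) / 2)\<^sup>2\<close>, and squares are absorbed by the
  quadratic map, \<open>a\<^sup>2 f \<xi> = f (a \<xi>)\<close> (\<open>smooth_curves_saturate_relaxed_forcings\<close>).

  A single term \<open>- f \<xi>\<close> is produced by a fast oscillation
  (\<open>oscillation_replaces_quadratic_term\<close>). Put \<open>\<zeta> t = sqrt 2 sin (\<omega> t) \<xi> t\<close>. In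
  \<open>f (v + \<zeta>) = f v + 2 sqrt 2 sin (\<omega> t) \<Gamma> v \<xi> + (1 - cos (2 \<omega> t)) f \<xi>\<close> the oscillating terms
  average out, so the solution of \<open>v' + A (v + \<zeta>) + f (v + \<zeta>) = g\<close> is uniformly close to
  the trajectory with forcing \<open>g - f \<xi>\<close> once \<open>\<omega>\<close> is large. On the other hand \<open>y = v + \<zeta>\<close> is a
  trajectory with forcing \<open>g + \<zeta>'\<close>, and \<open>\<zeta>'\<close> has values in the same space as \<open>\<xi>\<close>. The function \<open>\<zeta>\<close> is not
  uniformly small, but it is bounded with small integrals, so it is small in the relaxation
  norm; \<open>z\<close>, into whose equation \<open>x\<close> enters linearly, does not feel it in the limit; and \<open>\<zeta>\<close> vanishes at
  both ends when \<open>\<omega> \<tau>\<close> is a multiple of \<open>\<pi>\<close>.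

  Both closeness to the averaged system and existence on the whole interval come from one fact on ordinary
  differential equations: a curve that satisfies the integrated equation up to a small error has an exact
  solution nearby (\<open>solution_near_approximate_solution\<close>). The equation for the target is given in the weak
  sense; \<open>du_Bois_Reymond\<close> turns it into an integral equation. Finally, trajectories are unique, so the
  estimate for the constructed one holds for every solution with the same control.
\<close>

section \<open>Smooth functions and curves\<close>

text \<open>Coinduction for smoothness: instead of formulas for all derivatives it is enough to find a class of
functions around \<open>h\<close> that is closed under differentiation.\<close>

lemma C_infinity_on_coinduct:
  assumes "h \<in> H"
    and H: "\<And>h. h \<in> H \<Longrightarrow> \<exists>h'\<in>H. \<forall>t\<in>S. (h has_vector_derivative h' t) (at t within S)"
  shows "C_infinity_on S h"
proof -
  obtain d where d: "\<And>h. h \<in> H \<Longrightarrow> d h \<in> H \<and> (\<forall>t\<in>S. (h has_vector_derivative d h t) (at t within S))"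
    using H by metis
  have "(d ^^ n) h \<in> H" for n
    by (induction n) (auto simp: assms(1) d)
  then show ?thesis
    unfolding C_infinity_on_def by (intro exI[of _ "\<lambda>n. (d ^^ n) h"]) (auto simp: d)
qed

lemma C_infinity_on_derivative:
  assumes "C_infinity_on S u"
  shows "\<exists>u'. C_infinity_on S u' \<and> (\<forall>t\<in>S. (u has_vector_derivative u' t) (at t within S))"
proof -
  obtain D where D: "D 0 = u" "\<And>n t. t \<in> S \<Longrightarrow> (D n has_vector_derivative D (Suc n) t) (at t within S)"
    using assms unfolding C_infinity_on_def by blast
  have "C_infinity_on S (D 1)"
    unfolding C_infinity_on_def by (intro exI[of _ "\<lambda>n. D (Suc n)"]) (auto simp: D)
  moreover have "(u has_vector_derivative D 1 t) (at t within S)" if "t \<in> S" for t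
    using D(2)[OF that, of 0] D(1) by simp
  ultimately show ?thesis by auto
qed

lemma C_infinity_on_subset: "C_infinity_on T u \<Longrightarrow> S \<subseteq> T \<Longrightarrow> C_infinity_on S u"
  unfolding C_infinity_on_def by (metis has_vector_derivative_within_subset subsetD)

lemma C_infinity_on_imp_continuous:
  assumes "C_infinity_on S u" shows "continuous_on S u"
proof -
  obtain u' where "C_infinity_on S u'"
    and "\<And>t. t \<in> S \<Longrightarrow> (u has_vector_derivative u' t) (at t within S)"
    using C_infinity_on_derivative[OF assms] by auto
  then show ?thesis
    by (auto simp: continuous_on_eq_continuous_within intro: has_vector_derivative_continuous)
qed

text \<open>The linear span of \<open>G\<close> for pointwise operations.\<close>

inductive_set lincombs :: "('b \<Rightarrow> 'a::real_vector) set \<Rightarrow> ('b \<Rightarrow> 'a) set" for G where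
  zero: "(\<lambda>t. 0) \<in> lincombs G"
| step: "g \<in> G \<Longrightarrow> h \<in> lincombs G \<Longrightarrow> (\<lambda>t. c *\<^sub>R g t + h t) \<in> lincombs G"

lemma lincombs_add: "h \<in> lincombs G \<Longrightarrow> k \<in> lincombs G \<Longrightarrow> (\<lambda>t. h t + k t) \<in> lincombs G"
proof (induction rule: lincombs.induct)
  case (step g h c)
  then show ?case using lincombs.step[of g G "\<lambda>t. h t + k t" c] by (simp add: add.assoc)
qed simp

lemma lincombs_scale: "h \<in> lincombs G \<Longrightarrow> (\<lambda>t. c *\<^sub>R h t) \<in> lincombs G"
proof (induction rule: lincombs.induct)
  case zero then show ?case using lincombs.zero by simp
next
  case (step g h d)
  then show ?case using lincombs.step[of g G "\<lambda>t. c *\<^sub>R h t" "c * d"] by (simp add: scaleR_right_distrib)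
qed

lemma lincombs_base: "g \<in> G \<Longrightarrow> g \<in> lincombs G"
  using lincombs.step[OF _ lincombs.zero, of g G 1] by simp

text \<open>By linearity closedness under differentiation only has to be checked on generators, and the derivative of
a generator may be a sum. Applied to products of derivatives this replaces the Leibniz formula.\<close>

lemma lincombs_derivative:
  assumes G: "\<And>g. g \<in> G \<Longrightarrow> \<exists>g'\<in>lincombs G. \<forall>t\<in>S. (g has_vector_derivative g' t) (at t within S)"
    and "h \<in> lincombs G"
  shows "\<exists>h'\<in>lincombs G. \<forall>t\<in>S. (h has_vector_derivative h' t) (at t within S)"
  using assms(2)
proof (induction rule: lincombs.induct)
  case zero
  show ?case by (rule bexI[OF _ lincombs.zero]) auto
next
  case (step g h c)
  obtain g' where g': "g' \<in> lincombs G" "\<forall>t\<in>S. (g has_vector_derivative g' t) (at t within S)"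
    using G step.hyps by blast
  obtain h' where h': "h' \<in> lincombs G" "\<forall>t\<in>S. (h has_vector_derivative h' t) (at t within S)"
    using step.IH by blast
  show ?case
    by (rule bexI[OF _ lincombs_add[OF lincombs_scale[OF g'(1)] h'(1), of c]])
      (use g'(2) h'(2) in \<open>auto intro!: derivative_eq_intros\<close>)
qed

lemma C_infinity_on_lincombs:
  assumes "\<And>g. g \<in> G \<Longrightarrow> \<exists>g'\<in>lincombs G. \<forall>t\<in>S. (g has_vector_derivative g' t) (at t within S)"
    and "h \<in> lincombs G"
  shows "C_infinity_on S h"
  by (rule C_infinity_on_coinduct[OF assms(2) lincombs_derivative[OF assms(1)]])

lemma C_infinity_on_scaleR:
  fixes a :: "real \<Rightarrow> real" and u :: "real \<Rightarrow> 'a::real_normed_vector"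
  assumes "C_infinity_on S a" "C_infinity_on S u"
  shows "C_infinity_on S (\<lambda>t. a t *\<^sub>R u t)"
proof -
  obtain D where D: "D 0 = a" "\<And>n t. t \<in> S \<Longrightarrow> (D n has_vector_derivative D (Suc n) t) (at t within S)"
    using assms unfolding C_infinity_on_def by blast
  obtain E where E: "E 0 = u" "\<And>n t. t \<in> S \<Longrightarrow> (E n has_vector_derivative E (Suc n) t) (at t within S)"
    using assms unfolding C_infinity_on_def by blast
  let ?G = "{\<lambda>t. D i t *\<^sub>R E j t | i j. True}"
  have G: "(\<lambda>t. D i t *\<^sub>R E j t) \<in> ?G" for i j by auto
  show ?thesis
  proof (rule C_infinity_on_lincombs[of ?G])
    show "(\<lambda>t. a t *\<^sub>R u t) \<in> lincombs ?G" using D E G[of 0 0] by (auto intro: lincombs_base)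
    fix g assume "g \<in> ?G"
    then obtain i j where g: "g = (\<lambda>t. D i t *\<^sub>R E j t)" by auto
    have "(\<lambda>t. D i t *\<^sub>R E (Suc j) t + D (Suc i) t *\<^sub>R E j t) \<in> lincombs ?G"
      by (intro lincombs_add lincombs_base G)
    moreover have "(g has_vector_derivative D i t *\<^sub>R E (Suc j) t + D (Suc i) t *\<^sub>R E j t) (at t within S)"
      if "t \<in> S" for t
      unfolding g using D(2)[OF that, of i] E(2)[OF that, of j]
      by (intro has_vector_derivative_scaleR) (auto simp: has_real_derivative_iff_has_vector_derivative)
    ultimately show "\<exists>g'\<in>lincombs ?G. \<forall>t\<in>S. (g has_vector_derivative g' t) (at t within S)"
      by (intro bexI[of _ "\<lambda>t. D i t *\<^sub>R E (Suc j) t + D (Suc i) t *\<^sub>R E j t"]) auto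
  qed
qed

lemma C_infinity_on_mult:
  fixes a b :: "real \<Rightarrow> real"
  shows "C_infinity_on S a \<Longrightarrow> C_infinity_on S b \<Longrightarrow> C_infinity_on S (\<lambda>t. a t * b t)"
  using C_infinity_on_scaleR[of S a b] by simp

lemma C_infinity_on_const: "C_infinity_on S (\<lambda>t. c)"
  by (rule C_infinity_on_coinduct[of _ "range (\<lambda>c t. c)"]) (auto intro!: exI[of _ 0])

lemma C_infinity_on_add:
  assumes "C_infinity_on S u" "C_infinity_on S v"
  shows "C_infinity_on S (\<lambda>t. u t + v t)"
proof -
  obtain D where D: "D 0 = u" "\<And>n t. t \<in> S \<Longrightarrow> (D n has_vector_derivative D (Suc n) t) (at t within S)"
    using assms unfolding C_infinity_on_def by blast
  obtain E where E: "E 0 = v" "\<And>n t. t \<in> S \<Longrightarrow> (E n has_vector_derivative E (Suc n) t) (at t within S)"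
    using assms unfolding C_infinity_on_def by blast
  show ?thesis unfolding C_infinity_on_def
    by (intro exI[of _ "\<lambda>n t. D n t + E n t"]) (auto simp: D E intro!: has_vector_derivative_add)
qed

lemma C_infinity_on_ident: "C_infinity_on S (\<lambda>t. t)"
proof (rule C_infinity_on_coinduct[of _ "insert (\<lambda>t. t) (range (\<lambda>c t. c))"])
  fix h :: "real \<Rightarrow> real" assume "h \<in> insert (\<lambda>t. t) (range (\<lambda>c t. c))"
  then consider "h = (\<lambda>t. t)" | c where "h = (\<lambda>t. c)" by blast
  then show "\<exists>h'\<in>insert (\<lambda>t. t) (range (\<lambda>c t. c)). \<forall>t\<in>S. (h has_vector_derivative h' t) (at t within S)"
  proof cases
    case 1 then show ?thesis by (intro bexI[of _ "\<lambda>t. 1"]) auto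
  next
    case 2 then show ?thesis by (intro bexI[of _ "\<lambda>t. 0"]) auto
  qed
qed auto

lemma C_infinity_on_trig:
  fixes \<omega> a b :: real
  shows "C_infinity_on S (\<lambda>t. a * sin (\<omega> * t) + b * cos (\<omega> * t))"
proof (rule C_infinity_on_coinduct[of _ "{\<lambda>t. a * sin (\<omega> * t) + b * cos (\<omega> * t) | a b. True}"])
  fix h assume "h \<in> {\<lambda>t. a * sin (\<omega> * t) + b * cos (\<omega> * t) | a b. True}"
  then obtain a b where h: "h = (\<lambda>t. a * sin (\<omega> * t) + b * cos (\<omega> * t))" by blast
  have "(h has_vector_derivative (- b * \<omega>) * sin (\<omega> * t) + (a * \<omega>) * cos (\<omega> * t)) (at t within S)" for t
    unfolding h has_real_derivative_iff_has_vector_derivative[symmetric]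
    by (auto intro!: derivative_eq_intros simp: algebra_simps)
  then show "\<exists>h'\<in>{\<lambda>t. a * sin (\<omega> * t) + b * cos (\<omega> * t) | a b. True}.
      \<forall>t\<in>S. (h has_vector_derivative h' t) (at t within S)"
    by (intro bexI[of _ "\<lambda>t. (- b * \<omega>) * sin (\<omega> * t) + (a * \<omega>) * cos (\<omega> * t)"])
      (rule ballI, assumption, rule CollectI, intro exI conjI, rule refl, rule TrueI)
qed auto

lemma C_infinity_affine:
  assumes "C_infinity_on UNIV u"
  shows "C_infinity_on UNIV (\<lambda>t. u (c * t + d))"
proof -
  obtain D where D: "D 0 = u" "\<And>n t. (D n has_vector_derivative D (Suc n) t) (at t)"
    using assms unfolding C_infinity_on_def by auto
  have *: "((\<lambda>t. c * t + d) has_vector_derivative c) (at t)" for t :: real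
    unfolding has_real_derivative_iff_has_vector_derivative[symmetric]
    by (auto intro!: derivative_eq_intros)
  have "((\<lambda>t. c ^ n *\<^sub>R D n (c * t + d)) has_vector_derivative c ^ Suc n *\<^sub>R D (Suc n) (c * t + d)) (at t)" for n t
    using has_vector_derivative_scaleR[OF DERIV_const vector_diff_chain_at[OF *, of "D n" _ t, OF D(2)], of "c ^ n"]
    by (simp add: o_def mult.commute)
  then show ?thesis unfolding C_infinity_on_def
    by (intro exI[of _ "\<lambda>n t. c ^ n *\<^sub>R D n (c * t + d)"]) (auto simp: D)
qed

text \<open>The curves \<open>\<Sum> a\<^sub>i e\<^sub>i\<close> with smooth scalar functions \<open>a\<^sub>i\<close> and fixed \<open>e\<^sub>i \<in> E\<close>. For a finite-dimensional subspace \<open>E\<close> these are the smooth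
\<open>E\<close>-valued curves. With the \<open>e\<^sub>i\<close> visible, derivatives obviously stay in the class, and curves
with values in an image can be lifted term by term.\<close>

definition smooth_curves :: "'x::real_normed_vector set \<Rightarrow> (real \<Rightarrow> 'x) set" where
  "smooth_curves E = lincombs {\<lambda>t. a t *\<^sub>R e | a e. C_infinity_on UNIV a \<and> e \<in> E}"

lemma smooth_curves_single: "C_infinity_on UNIV a \<Longrightarrow> e \<in> E \<Longrightarrow> (\<lambda>t. a t *\<^sub>R e) \<in> smooth_curves E"
  unfolding smooth_curves_def by (intro lincombs_base) blast

lemma smooth_curves_zero: "(\<lambda>t. 0) \<in> smooth_curves E"
  unfolding smooth_curves_def by (rule lincombs.zero)

lemma smooth_curves_add:
  "h \<in> smooth_curves E \<Longrightarrow> k \<in> smooth_curves E \<Longrightarrow> (\<lambda>t. h t + k t) \<in> smooth_curves E"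
  unfolding smooth_curves_def by (rule lincombs_add)

lemma smooth_curves_induct [consumes 1, case_names zero step]:
  assumes "h \<in> smooth_curves E"
    and "P (\<lambda>t. 0)"
    and "\<And>a e h. C_infinity_on UNIV a \<Longrightarrow> e \<in> E \<Longrightarrow> h \<in> smooth_curves E \<Longrightarrow> P h
      \<Longrightarrow> P (\<lambda>t. a t *\<^sub>R e + h t)"
  shows "P h"
  using assms(1) unfolding smooth_curves_def
proof (induction rule: lincombs.induct)
  case zero show ?case by fact
next
  case (step g h c)
  then obtain a e where g: "g = (\<lambda>t. a t *\<^sub>R e)" "C_infinity_on UNIV a" "e \<in> E" by blast
  show ?case
    using assms(3)[OF C_infinity_on_mult[OF C_infinity_on_const g(2), of c] g(3), of h] step
    by (simp add: g(1) smooth_curves_def)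
qed

lemma smooth_curves_sum:
  "finite I \<Longrightarrow> (\<And>i. i \<in> I \<Longrightarrow> h i \<in> smooth_curves E) \<Longrightarrow> (\<lambda>t. \<Sum>i\<in>I. h i t) \<in> smooth_curves E"
  by (induction rule: finite_induct) (auto intro: smooth_curves_zero smooth_curves_add)

lemma smooth_curves_scaleR:
  assumes "C_infinity_on UNIV a" "h \<in> smooth_curves E"
  shows "(\<lambda>t. a t *\<^sub>R h t) \<in> smooth_curves E"
  using assms(2)
proof (induction rule: smooth_curves_induct)
  case zero then show ?case using smooth_curves_zero by simp
next
  case (step b e h)
  show ?case
    using smooth_curves_add[OF smooth_curves_single[OF C_infinity_on_mult[OF assms(1) step(1)] step(2)] step(4)]
    by (simp add: scaleR_right_distrib)
qed

lemma smooth_curves_derivative: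
  assumes "h \<in> smooth_curves E"
  shows "\<exists>h'\<in>smooth_curves E. \<forall>t. (h has_vector_derivative h' t) (at t)"
proof -
  let ?G = "{\<lambda>t. a t *\<^sub>R e | a e. C_infinity_on UNIV a \<and> e \<in> E}"
  have "\<exists>h'\<in>lincombs ?G. \<forall>t\<in>UNIV. (h has_vector_derivative h' t) (at t within UNIV)"
  proof (rule lincombs_derivative)
    show "h \<in> lincombs ?G" using assms unfolding smooth_curves_def .
    fix g assume "g \<in> ?G"
    then obtain a e where g: "g = (\<lambda>t. a t *\<^sub>R e)" "C_infinity_on UNIV a" "e \<in> E" by blast
    obtain a' where a': "C_infinity_on UNIV a'" "\<And>t. (a has_vector_derivative a' t) (at t)"
      using C_infinity_on_derivative[OF g(2)] by auto
    have "(\<lambda>t. a' t *\<^sub>R e) \<in> lincombs ?G" using a' g by (intro lincombs_base) blast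
    moreover have "(g has_vector_derivative a' t *\<^sub>R e) (at t)" for t
      unfolding g using a'(2)[of t]
      by (auto intro!: derivative_eq_intros simp: has_real_derivative_iff_has_vector_derivative)
    ultimately show "\<exists>g'\<in>lincombs ?G. \<forall>t\<in>UNIV. (g has_vector_derivative g' t) (at t within UNIV)"
      by (intro bexI[of _ "\<lambda>t. a' t *\<^sub>R e"]) auto
  qed
  then show ?thesis unfolding smooth_curves_def by simp
qed

lemma smooth_curves_C_infinity: "h \<in> smooth_curves E \<Longrightarrow> C_infinity_on UNIV h"
  by (rule C_infinity_on_coinduct[of _ "smooth_curves E"]) (use smooth_curves_derivative in auto)

lemma smooth_curves_linear_image:
  assumes "linear L" "h \<in> smooth_curves E"
  shows "(\<lambda>t. L (h t)) \<in> smooth_curves (L ` E)"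
  using assms(2)
proof (induction rule: smooth_curves_induct)
  case zero then show ?case using smooth_curves_zero by (simp add: linear_0[OF assms(1)])
next
  case (step a e h)
  show ?case
    using smooth_curves_add[OF smooth_curves_single[OF step(1), of "L e" "L ` E"] step(4)] step(2)
    by (simp add: linear_add[OF assms(1)] linear_cmul[OF assms(1)])
qed

lemma smooth_curves_mono:
  assumes "h \<in> smooth_curves E" "E \<subseteq> E'"
  shows "h \<in> smooth_curves E'"
  using assms(1)
proof (induction rule: smooth_curves_induct)
  case zero show ?case by (rule smooth_curves_zero)
next
  case (step a e h)
  then show ?case
    using smooth_curves_add[OF smooth_curves_single[OF step(1)] step(4)] assms(2) by blast
qed

text \<open>This recovers the control from a forcing with values in the range of the control operator.\<close>

lemma smooth_curves_lift:
  assumes "linear B" "h \<in> smooth_curves (range B)"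
  obtains u where "u \<in> smooth_curves UNIV" "\<And>t. B (u t) = h t"
proof -
  have "\<exists>u\<in>smooth_curves UNIV. \<forall>t. B (u t) = h t"
    using assms(2)
  proof (induction rule: smooth_curves_induct)
    case zero
    show ?case by (rule bexI[OF _ smooth_curves_zero]) (simp add: linear_0[OF assms(1)])
  next
    case (step a e h)
    then obtain u v where "u \<in> smooth_curves UNIV" "\<And>t. B (u t) = h t" "e = B v" by blast
    with step(1) show ?case
      by (intro bexI[of _ "\<lambda>t. a t *\<^sub>R v + u t"] smooth_curves_add smooth_curves_single)
        (auto simp: linear_add[OF assms(1)] linear_cmul[OF assms(1)])
  qed
  with that show thesis by blast
qed

lemma smooth_curves_bilinear:
  assumes \<Gamma>: "bilinear \<Gamma>" and "h \<in> smooth_curves UNIV" "k \<in> smooth_curves UNIV"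
  shows "(\<lambda>t. \<Gamma> (h t) (k t)) \<in> smooth_curves UNIV"
  using assms(2)
proof (induction rule: smooth_curves_induct)
  case zero then show ?case using smooth_curves_zero by (simp add: bilinear_lzero[OF \<Gamma>])
next
  case (step a e h)
  have "linear (\<Gamma> e)" using \<Gamma> unfolding bilinear_def by blast
  then have "(\<lambda>t. \<Gamma> e (k t)) \<in> smooth_curves UNIV"
    using smooth_curves_mono[OF smooth_curves_linear_image[OF _ assms(3)] subset_UNIV] by blast
  from smooth_curves_add[OF smooth_curves_scaleR[OF step(1) this] step(4)]
  show ?case by (simp add: bilinear_ladd[OF \<Gamma>] bilinear_lmul[OF \<Gamma>])
qed

lemma polynomial_function_smooth_curves:
  fixes p :: "real \<Rightarrow> 'x::euclidean_space"
  assumes "polynomial_function p"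
  shows "p \<in> smooth_curves UNIV"
proof -
  have C: "C_infinity_on UNIV q" if "real_polynomial_function q" for q :: "real \<Rightarrow> real"
    using that
  proof (induction rule: real_polynomial_function.induct)
    case (linear q)
    have "q t = t * q 1" for t
      using linear_cmul[OF bounded_linear.linear[OF linear], of t 1] by simp
    then have "q = (\<lambda>t. t * q 1)" by (rule ext)
    moreover have "C_infinity_on UNIV (\<lambda>t. t * q 1)"
      by (rule C_infinity_on_mult[OF C_infinity_on_ident C_infinity_on_const])
    ultimately show ?case by (simp only:)
  next
    case (const c) show ?case by (rule C_infinity_on_const)
  next
    case (add p q) show ?case by (rule C_infinity_on_add) fact+
  next
    case (mult p q) show ?case by (rule C_infinity_on_mult) fact+
  qed
  have "C_infinity_on UNIV (\<lambda>t. p t \<bullet> b)" for b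
    using C[of "\<lambda>t. p t \<bullet> b"] assms bounded_linear_inner_left[of b]
    unfolding polynomial_function_def o_def by auto
  then have "(\<lambda>t. \<Sum>b\<in>Basis. (p t \<bullet> b) *\<^sub>R b) \<in> smooth_curves UNIV"
    by (intro smooth_curves_sum smooth_curves_single) auto
  then show ?thesis by (simp add: euclidean_representation)
qed

text \<open>The forcings \<open>\<eta> - f \<xi>\<^sub>1 - \<dots> - f \<xi>\<^sub>p\<close> with smooth curves in \<open>E\<close>: the time-dependent version of
the saturation cone, built one quadratic term at a time because oscillations remove one term at a time.\<close>

inductive_set relaxed_forcings :: "('x::real_normed_vector \<Rightarrow> 'x) \<Rightarrow> 'x set \<Rightarrow> (real \<Rightarrow> 'x) set"
  for f E where
  base: "h \<in> smooth_curves E \<Longrightarrow> h \<in> relaxed_forcings f E"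
| step: "h \<in> relaxed_forcings f E \<Longrightarrow> \<xi> \<in> smooth_curves E \<Longrightarrow> (\<lambda>t. h t - f (\<xi> t)) \<in> relaxed_forcings f E"

lemma relaxed_forcings_add:
  assumes "h \<in> relaxed_forcings f E" "k \<in> relaxed_forcings f E"
  shows "(\<lambda>t. h t + k t) \<in> relaxed_forcings f E"
  using assms(2)
proof (induction rule: relaxed_forcings.induct)
  case (base k)
  show ?case using assms(1)
  proof (induction rule: relaxed_forcings.induct)
    case (base h) with \<open>k \<in> smooth_curves E\<close> show ?case
      by (intro relaxed_forcings.base smooth_curves_add)
  next
    case (step h \<xi>)
    then show ?case using relaxed_forcings.step[OF step.IH step.hyps(2)] by (simp add: algebra_simps)
  qed
next
  case (step k \<xi>)
  then show ?case using relaxed_forcings.step[OF step.IH step.hyps(2)] by (simp add: algebra_simps)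
qed

text \<open>As \<open>f\<close> is homogeneous of degree two, the factor \<open>a\<^sup>2\<close> in front of \<open>f \<xi>\<close> becomes the factor \<open>a\<close> of \<open>\<xi>\<close>. Using
squares of smooth functions, and not square roots of nonnegative ones, keeps the curves smooth.\<close>

lemma relaxed_forcings_square_scaleR:
  assumes \<Gamma>: "bilinear \<Gamma>" and f: "\<And>x. f x = \<Gamma> x x"
    and a: "C_infinity_on UNIV a" and "h \<in> relaxed_forcings f E"
  shows "(\<lambda>t. (a t)\<^sup>2 *\<^sub>R h t) \<in> relaxed_forcings f E"
  using assms(4)
proof (induction rule: relaxed_forcings.induct)
  case (base h)
  then show ?case unfolding power2_eq_square
    by (intro relaxed_forcings.base smooth_curves_scaleR C_infinity_on_mult a)
next
  case (step h \<xi>)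
  show ?case using relaxed_forcings.step[OF step(3) smooth_curves_scaleR[OF a step(2)]]
    by (simp add: f bilinear_lmul[OF \<Gamma>] bilinear_rmul[OF \<Gamma>] power2_eq_square scaleR_diff_right)
qed

lemma saturation_cone_relaxed_forcings:
  assumes "\<gamma> \<in> saturation_cone f E"
  shows "(\<lambda>t. \<gamma>) \<in> relaxed_forcings f E"
proof -
  obtain p :: nat and \<xi> where \<gamma>: "\<gamma> = \<xi> 0 - (\<Sum>i=1..p. f (\<xi> i))" "\<forall>i\<le>p. \<xi> i \<in> E"
    using assms unfolding saturation_cone_def by blast
  have const: "(\<lambda>t. e) \<in> smooth_curves E" if "e \<in> E" for e
    using smooth_curves_single[OF C_infinity_on_const that, of 1] by simp
  have "(\<lambda>t. \<xi> 0 - (\<Sum>i=1..q. f (\<xi> i))) \<in> relaxed_forcings f E" if "q \<le> p" for q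
    using that
  proof (induction q)
    case 0 then show ?case using \<gamma>(2) by (auto intro!: relaxed_forcings.base const)
  next
    case (Suc q)
    then show ?case using relaxed_forcings.step[OF Suc.IH const, of "\<xi> (Suc q)"] \<gamma>(2)
      by (simp add: algebra_simps)
  qed
  with \<gamma>(1) show ?thesis by simp
qed

text \<open>A generator \<open>e\<close> of the saturated space lies in the saturation cone together with \<open>- e\<close>. Cone elements
may only be multiplied by nonnegative numbers, so the coefficient \<open>a\<close> of \<open>e\<close> is split into squares,
\<open>a e = ((a + 1) / 2)\<^sup>2 e + ((a - 1) / 2)\<^sup>2 (- e)\<close>.\<close>

lemma smooth_curves_saturate_relaxed_forcings:
  assumes E: "subspace E" and \<Gamma>: "bilinear \<Gamma>" and f: "\<And>x. f x = \<Gamma> x x"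
    and "h \<in> smooth_curves (saturate f E)"
  shows "h \<in> relaxed_forcings f E"
  using assms(4)
proof (induction rule: smooth_curves_induct)
  case zero then show ?case by (intro relaxed_forcings.base smooth_curves_zero)
next
  case (step a e h)
  have half: "C_infinity_on UNIV (\<lambda>t. (1/2) * (a t + c))" for c
    by (intro C_infinity_on_mult C_infinity_on_add C_infinity_on_const step(1))
  have "e \<in> saturation_cone f E" "- e \<in> saturation_cone f E"
    using step(2) saturate_eq[OF E \<Gamma> f] by auto
  note sq = relaxed_forcings_square_scaleR[OF \<Gamma> f half saturation_cone_relaxed_forcings]
  have "(\<lambda>t. ((1/2) * (a t + 1))\<^sup>2 *\<^sub>R e + ((1/2) * (a t + (-1)))\<^sup>2 *\<^sub>R (- e)) \<in> relaxed_forcings f E"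
    using sq[OF \<open>e \<in> saturation_cone f E\<close>, of 1] sq[OF \<open>- e \<in> saturation_cone f E\<close>, of "-1"]
    by (rule relaxed_forcings_add)
  moreover have "((1/2) * (a t + 1))\<^sup>2 *\<^sub>R e + ((1/2) * (a t + (-1)))\<^sup>2 *\<^sub>R (- e) = a t *\<^sub>R e" for t
  proof -
    have "((1/2) * (a t + 1))\<^sup>2 - ((1/2) * (a t + (-1)))\<^sup>2 = a t" by (simp add: power2_eq_square field_simps)
    then show ?thesis by (metis scaleR_left_diff_distrib scaleR_minus_right diff_conv_add_uminus)
  qed
  ultimately have "(\<lambda>t. a t *\<^sub>R e) \<in> relaxed_forcings f E" by (simp only:)
  then show ?case using step(4) by (rule relaxed_forcings_add)
qed

section \<open>Solutions near approximate solutions\<close>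

text \<open>The integral inequality says that \<open>exp (- L t) (\<delta> + L \<integral> u)\<close> has a nonpositive derivative.\<close>

lemma gronwall:
  fixes u :: "real \<Rightarrow> real"
  assumes u: "continuous_on {0..\<tau>} u" and L: "L \<ge> 0"
    and le: "\<And>t. t \<in> {0..\<tau>} \<Longrightarrow> u t \<le> \<delta> + L * integral {0..t} u"
    and t: "t \<in> {0..\<tau>}"
  shows "u t \<le> \<delta> * exp (L * t)"
proof -
  define W where "W s = exp (- L * s) * (\<delta> + L * integral {0..s} u)" for s
  have dW: "(W has_real_derivative L * exp (- L * s) * (u s - (\<delta> + L * integral {0..s} u))) (at s within {0..\<tau>})"
    if "s \<in> {0..\<tau>}" for s
  proof -
    have "((\<lambda>s. integral {0..s} u) has_real_derivative u s) (at s within {0..\<tau>})"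
      using integral_has_vector_derivative[OF u that] by (simp add: has_real_derivative_iff_has_vector_derivative)
    then show ?thesis unfolding W_def
      by (auto intro!: derivative_eq_intros simp: algebra_simps)
  qed
  have "W t \<le> W 0"
  proof (rule DERIV_nonpos_imp_decreasing_open[of 0 t W])
    show "0 \<le> t" using t by simp
    have "continuous_on {0..\<tau>} W"
      unfolding continuous_on_eq_continuous_within by (intro ballI DERIV_continuous[OF dW])
    then show "continuous_on {0..t} W"
      by (rule continuous_on_subset) (use t in simp)
    fix s assume s: "0 < s" "s < t"
    then have "(W has_real_derivative L * exp (- L * s) * (u s - (\<delta> + L * integral {0..s} u))) (at s)"
      using dW[of s] t at_within_Icc_at[of 0 s \<tau>] by auto
    moreover have "L * exp (- L * s) * (u s - (\<delta> + L * integral {0..s} u)) \<le> 0"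
      using le[of s] s t L by (intro mult_nonneg_nonpos) auto
    ultimately show "\<exists>y. (W has_real_derivative y) (at s) \<and> y \<le> 0" by blast
  qed
  then have "exp (L * t) * (exp (- L * t) * (\<delta> + L * integral {0..t} u)) \<le> exp (L * t) * \<delta>"
    unfolding W_def by (intro mult_left_mono) auto
  moreover have "exp (L * t) * (exp (- L * t) * X) = X" for X :: real
    by (simp add: exp_minus)
  ultimately have "\<delta> + L * integral {0..t} u \<le> \<delta> * exp (L * t)"
    by (simp only: mult.commute[of \<delta>])
  with le[OF t] show ?thesis by linarith
qed

text \<open>The Picard operator is a contraction for a weighted supremum norm, so that no continuation of
local solutions is needed. Continuity of \<open>K\<close> is only used along continuous curves.\<close>

lemma picard_lindelof_global:
  fixes K :: "real \<Rightarrow> 'a::euclidean_space \<Rightarrow> 'a"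
  assumes \<tau>: "\<tau> \<ge> 0" and L: "L \<ge> 0"
    and cont: "\<And>q. continuous_on {0..\<tau>} q \<Longrightarrow> continuous_on {0..\<tau>} (\<lambda>s. K s (q s))"
    and lip: "\<And>s q r. s \<in> {0..\<tau>} \<Longrightarrow> norm (K s q - K s r) \<le> L * norm (q - r)"
  obtains q where "continuous_on {0..\<tau>} q"
    and "\<And>t. t \<in> {0..\<tau>} \<Longrightarrow> q t = q0 + integral {0..t} (\<lambda>s. K s (q s))"
proof -
  \<comment> \<open>The unknown is \<open>\<phi> t = exp (- \<rho> t) q t\<close>; any \<open>\<rho> > L\<close> gives the contraction factor \<open>L / \<rho> < 1\<close>.\<close>
  define \<rho> where "\<rho> = L + 1"
  have \<rho>: "\<rho> > 0" using L by (simp add: \<rho>_def)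
  define N where "N \<phi> t = exp (- \<rho> * t) *\<^sub>R (q0 + integral {0..t} (\<lambda>s. K s (exp (\<rho> * s) *\<^sub>R \<phi> s)))" for \<phi> t
  have contK: "continuous_on {0..\<tau>} (\<lambda>s. K s (exp (\<rho> * s) *\<^sub>R apply_bcontfun \<phi> s))" for \<phi>
    by (intro cont continuous_intros continuous_on_apply_bcontfun)
  have contN: "continuous_on {0..\<tau>} (N (apply_bcontfun \<phi>))" for \<phi>
    unfolding N_def
    by (intro continuous_intros indefinite_integral_continuous_1 integrable_continuous_real contK)
  have "\<exists>\<psi> :: real \<Rightarrow>\<^sub>C 'a. \<forall>t. \<psi> t = N \<phi> (clamp 0 \<tau> t)" for \<phi> :: "real \<Rightarrow>\<^sub>C 'a"
    using continuous_on_cbox_bcontfunE[of 0 \<tau> "N \<phi>"] contN[of \<phi>] by (metis cbox_interval)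
  then obtain T :: "(real \<Rightarrow>\<^sub>C 'a) \<Rightarrow> (real \<Rightarrow>\<^sub>C 'a)" where T: "\<And>\<phi> t. T \<phi> t = N \<phi> (clamp 0 \<tau> t)"
    by metis
  have clamp: "clamp 0 \<tau> t \<in> {0..\<tau>}" for t :: real
    using clamp_in_interval[of 0 \<tau> t] \<tau> by simp
  have "dist (T \<phi>) (T \<psi>) \<le> (L / \<rho>) * dist \<phi> \<psi>" for \<phi> \<psi>
  proof -
    let ?d = "dist \<phi> \<psi>"
    have N: "norm (N \<phi> t - N \<psi> t) \<le> (L / \<rho>) * ?d" if t: "t \<in> {0..\<tau>}" for t
    proof -
      let ?k = "\<lambda>\<phi> s. K s (exp (\<rho> * s) *\<^sub>R apply_bcontfun \<phi> s)"
      have int: "?k \<phi> integrable_on {0..t}" for \<phi>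
        using t by (intro integrable_continuous_real continuous_on_subset[OF contK]) auto
      have e: "((\<lambda>s. (L * ?d) * exp (\<rho> * s)) has_integral (L * ?d / \<rho>) * exp (\<rho> * t) - (L * ?d / \<rho>) * exp (\<rho> * 0)) {0..t}"
        using t \<rho> by (intro fundamental_theorem_of_calculus)
          (auto simp: has_real_derivative_iff_has_vector_derivative[symmetric] intro!: derivative_eq_intros)
      have "norm (integral {0..t} (\<lambda>s. ?k \<phi> s - ?k \<psi> s)) \<le> integral {0..t} (\<lambda>s. (L * ?d) * exp (\<rho> * s))"
      proof (rule integral_norm_bound_integral)
        fix s assume s: "s \<in> {0..t}"
        have "norm (?k \<phi> s - ?k \<psi> s) \<le> L * norm (exp (\<rho> * s) *\<^sub>R \<phi> s - exp (\<rho> * s) *\<^sub>R \<psi> s)"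
          using s t by (intro lip) auto
        also have "norm (exp (\<rho> * s) *\<^sub>R \<phi> s - exp (\<rho> * s) *\<^sub>R \<psi> s) = exp (\<rho> * s) * dist (\<phi> s) (\<psi> s)"
          by (simp add: dist_norm flip: scaleR_diff_right)
        also have "L * \<dots> \<le> L * (exp (\<rho> * s) * ?d)"
          by (intro mult_left_mono dist_bounded L) auto
        finally show "norm (?k \<phi> s - ?k \<psi> s) \<le> (L * ?d) * exp (\<rho> * s)" by (simp add: mult_ac)
      qed (use int e in \<open>auto intro!: integrable_diff\<close>)
      also have "\<dots> \<le> (L * ?d / \<rho>) * exp (\<rho> * t)"
        using integral_unique[OF e] L \<rho> by simp
      finally have *: "norm (integral {0..t} (\<lambda>s. ?k \<phi> s - ?k \<psi> s)) \<le> (L * ?d / \<rho>) * exp (\<rho> * t)" .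
      have "N \<phi> t - N \<psi> t = exp (- \<rho> * t) *\<^sub>R integral {0..t} (\<lambda>s. ?k \<phi> s - ?k \<psi> s)"
        unfolding N_def by (simp add: int integral_diff flip: scaleR_diff_right)
      then have "norm (N \<phi> t - N \<psi> t) \<le> exp (- \<rho> * t) * ((L * ?d / \<rho>) * exp (\<rho> * t))"
        using mult_left_mono[OF *, of "exp (- \<rho> * t)"] by simp
      also have "\<dots> = (exp (- \<rho> * t) * exp (\<rho> * t)) * (L / \<rho>) * ?d" by (simp add: field_simps)
      also have "\<dots> = (L / \<rho>) * ?d" by (simp flip: exp_add)
      finally show ?thesis .
    qed
    show ?thesis
      using N[OF clamp] T by (intro dist_bound) (simp add: dist_norm)
  qed
  then have "\<exists>!\<phi>. T \<phi> = \<phi>"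
    using L \<rho> by (intro banach_fix_type[of "L / \<rho>"]) (auto simp: \<rho>_def)
  then obtain \<phi> where "T \<phi> = \<phi>" by blast
  then have \<phi>: "apply_bcontfun \<phi> t = N \<phi> t" if "t \<in> {0..\<tau>}" for t
    using that T[of \<phi> t] by simp
  show thesis
  proof (rule that)
    show "continuous_on {0..\<tau>} (\<lambda>t. exp (\<rho> * t) *\<^sub>R \<phi> t)"
      by (intro continuous_intros continuous_on_apply_bcontfun)
    show "exp (\<rho> * t) *\<^sub>R \<phi> t = q0 + integral {0..t} (\<lambda>s. K s (exp (\<rho> * s) *\<^sub>R \<phi> s))" if "t \<in> {0..\<tau>}" for t
      unfolding \<phi>[OF that] N_def by (simp flip: exp_add)
  qed
qed

text \<open>The field is modified away from the tube of radius 1 around \<open>p\<close> so as to become globally Lipschitz; then a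
solution exists on the whole interval, and Gronwall's inequality shows that it stays so close to \<open>p\<close> that it never
meets the modification. Hence the Lipschitz bound is only needed on the tube, and existence and the error
estimate come together. The defect is measured after integration: for an oscillating field it is
small although the difference of the fields is not.\<close>

lemma solution_near_approximate_solution:
  fixes K :: "real \<Rightarrow> 'a::euclidean_space \<Rightarrow> 'a"
  assumes \<tau>: "\<tau> \<ge> 0" and L: "L \<ge> 0" and p: "continuous_on {0..\<tau>} p"
    and cont: "\<And>q. continuous_on {0..\<tau>} q \<Longrightarrow> continuous_on {0..\<tau>} (\<lambda>s. K s (q s))"
    and lip: "\<And>s q r. s \<in> {0..\<tau>} \<Longrightarrow> q \<in> cball (p s) 1 \<Longrightarrow> r \<in> cball (p s) 1
      \<Longrightarrow> norm (K s q - K s r) \<le> L * norm (q - r)"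
    and defect: "\<And>t. t \<in> {0..\<tau>} \<Longrightarrow> norm (p t - p 0 - integral {0..t} (\<lambda>s. K s (p s))) \<le> \<delta>"
    and small: "\<delta> * exp (L * \<tau>) \<le> 1"
  obtains q where "q 0 = p 0"
    and "\<And>t. t \<in> {0..\<tau>} \<Longrightarrow> (q has_vector_derivative K t (q t)) (at t within {0..\<tau>})"
    and "\<And>t. t \<in> {0..\<tau>} \<Longrightarrow> norm (q t - p t) \<le> \<delta> * exp (L * \<tau>)"
proof -
  have \<delta>: "\<delta> \<ge> 0" using defect[of 0] \<tau> by simp
  \<comment> \<open>The nearest-point map onto the tube is 1-Lipschitz and the identity on the tube.\<close>
  define r where "r s y = p s + closest_point (cball 0 1) (y - p s)" for s y
  define M where "M s y = K s (r s y)" for s y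
  have r_in: "r s y \<in> cball (p s) 1" for s y
    using closest_point_in_set[of "cball 0 1" "y - p s"] by (simp add: r_def dist_norm)
  have r_eq: "r s y = y" if "y \<in> cball (p s) 1" for s y
    using that by (simp add: r_def closest_point_self dist_norm norm_minus_commute)
  have r_lip: "norm (r s y - r s z) \<le> norm (y - z)" for s y z
    using closest_point_lipschitz[of "cball 0 1" "y - p s" "z - p s"] by (simp add: r_def dist_norm)
  have r_cont: "continuous_on {0..\<tau>} (\<lambda>s. r s (q s))" if "continuous_on {0..\<tau>} q" for q
    unfolding r_def
    by (intro continuous_intros p continuous_on_compose2[OF continuous_on_closest_point[of "cball 0 1" UNIV]] that) auto
  have M_lip: "norm (M s y - M s z) \<le> L * norm (y - z)" if "s \<in> {0..\<tau>}" for s y z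
    unfolding M_def using lip[OF that r_in r_in] mult_left_mono[OF r_lip L] by (rule order_trans)
  have M_cont: "continuous_on {0..\<tau>} (\<lambda>s. M s (q s))" if "continuous_on {0..\<tau>} q" for q
    unfolding M_def by (rule cont[OF r_cont[OF that]])
  obtain q where q: "continuous_on {0..\<tau>} q"
    and qeq: "\<And>t. t \<in> {0..\<tau>} \<Longrightarrow> q t = p 0 + integral {0..t} (\<lambda>s. M s (q s))"
    using picard_lindelof_global[OF \<tau> L M_cont M_lip] by blast
  have near: "norm (q t - p t) \<le> \<delta> * exp (L * t)" if "t \<in> {0..\<tau>}" for t
  proof (rule gronwall[OF _ L _ that])
    show "continuous_on {0..\<tau>} (\<lambda>t. norm (q t - p t))"
      by (intro continuous_intros q p)
    fix t assume t: "t \<in> {0..\<tau>}"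
    have int: "(\<lambda>s. M s (y s)) integrable_on {0..t}" if "continuous_on {0..\<tau>} y" for y
      using t by (intro integrable_continuous_real continuous_on_subset[OF M_cont[OF that]]) auto
    have "(\<lambda>s. M s (p s)) = (\<lambda>s. K s (p s))" by (simp add: M_def r_eq)
    then have d: "norm (p t - p 0 - integral {0..t} (\<lambda>s. M s (p s))) \<le> \<delta>" using defect[OF t] by simp
    have "norm (integral {0..t} (\<lambda>s. M s (q s) - M s (p s))) \<le> integral {0..t} (\<lambda>s. L * norm (q s - p s))"
      using t by (intro integral_norm_bound_integral integrable_diff int q p M_lip integrable_continuous_real
          continuous_intros continuous_on_subset[OF q] continuous_on_subset[OF p]) auto
    then have "norm (integral {0..t} (\<lambda>s. M s (q s)) - integral {0..t} (\<lambda>s. M s (p s)))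
        \<le> L * integral {0..t} (\<lambda>s. norm (q s - p s))"
      by (simp add: integral_diff int q p)
    from this d have "norm ((integral {0..t} (\<lambda>s. M s (q s)) - integral {0..t} (\<lambda>s. M s (p s)))
        - (p t - p 0 - integral {0..t} (\<lambda>s. M s (p s)))) \<le> L * integral {0..t} (\<lambda>s. norm (q s - p s)) + \<delta>"
      by (rule order_trans[OF norm_triangle_ineq4 add_mono])
    then show "norm (q t - p t) \<le> \<delta> + L * integral {0..t} (\<lambda>s. norm (q s - p s))"
      by (simp add: qeq[OF t] algebra_simps)
  qed
  have near': "norm (q t - p t) \<le> \<delta> * exp (L * \<tau>)" if "t \<in> {0..\<tau>}" for t
  proof -
    have "\<delta> * exp (L * t) \<le> \<delta> * exp (L * \<tau>)"
      using that L \<delta> by (intro mult_left_mono) (auto intro: mult_left_mono)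
    with near[OF that] show ?thesis by linarith
  qed
  show thesis
  proof (rule that)
    show "q 0 = p 0" using qeq[of 0] \<tau> by simp
    show "norm (q t - p t) \<le> \<delta> * exp (L * \<tau>)" if "t \<in> {0..\<tau>}" for t by (rule near'[OF that])
    fix t assume t: "t \<in> {0..\<tau>}"
    have "((\<lambda>t. p 0 + integral {0..t} (\<lambda>s. M s (q s))) has_vector_derivative 0 + M t (q t)) (at t within {0..\<tau>})"
      by (intro has_vector_derivative_add has_vector_derivative_const
          integral_has_vector_derivative[OF M_cont[OF q] t])
    then have "(q has_vector_derivative M t (q t)) (at t within {0..\<tau>})"
      using has_vector_derivative_transform[OF t, of q] qeq by simp
    moreover have "M t (q t) = K t (q t)"
      unfolding M_def using near'[OF t] small by (subst r_eq) (auto simp: dist_norm norm_minus_commute)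
    ultimately show "(q has_vector_derivative K t (q t)) (at t within {0..\<tau>})" by simp
  qed
qed

section \<open>Smooth bump functions\<close>

text \<open>The function \<open>x powr (- k) * exp (- 1 / x)\<close>, extended by zero. All \<open>k\<close> are considered at once because
differentiation leads from one \<open>k\<close> to a combination of the next two.\<close>

definition flat :: "nat \<Rightarrow> real \<Rightarrow> real" where
  "flat k x = (if x > 0 then inverse x ^ k * exp (- inverse x) else 0)"

text \<open>At the origin the difference quotient of \<open>flat k\<close> is \<open>flat (k + 1)\<close>, which tends to zero because the
exponential beats every power.\<close>

lemma flat_derivative:
  "(flat k has_real_derivative flat (k + 2) x - real k * flat (k + 1) x) (at x)"
proof -
  consider "x < 0" | "x = 0" | "x > 0" by linarith
  then show ?thesis
  proof cases
    case 1
    have "((\<lambda>_. 0) has_real_derivative 0) (at x)" by simp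
    then have "(flat k has_real_derivative 0) (at x)"
      by (rule has_field_derivative_transform_within_open[where S = "{..<0}"])
        (use 1 in \<open>auto simp: flat_def\<close>)
    then show ?thesis using 1 by (simp add: flat_def)
  next
    case 3
    have "((\<lambda>x. inverse x ^ k * exp (- inverse x)) has_real_derivative flat (k + 2) x - real k * flat (k + 1) x) (at x)"
    proof -
      have "(inverse has_real_derivative - (inverse x * inverse x)) (at x)"
        using DERIV_inverse'[of "\<lambda>x. x" 1 x UNIV] 3 by simp
      note this[derivative_intros]
      have "((\<lambda>x. inverse x ^ k * exp (- inverse x)) has_real_derivative
          inverse x ^ k * (exp (- inverse x) * (inverse x * inverse x))
          + (real k * (- (inverse x * inverse x) * inverse x ^ (k - 1))) * exp (- inverse x)) (at x)"
        using 3 by (auto intro!: derivative_eq_intros)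
      moreover have "inverse x ^ k * (exp (- inverse x) * (inverse x * inverse x))
          + (real k * (- (inverse x * inverse x) * inverse x ^ (k - 1))) * exp (- inverse x)
          = flat (k + 2) x - real k * flat (k + 1) x"
        using 3 by (cases k) (simp_all add: flat_def algebra_simps)
      ultimately show ?thesis by (simp only:)
    qed
    then show ?thesis
      by (rule has_field_derivative_transform_within_open[where S = "{0<..}"])
        (use 3 in \<open>auto simp: flat_def\<close>)
  next
    case 2
    have "(flat (k + 1) \<longlongrightarrow> 0) (at 0)"
      unfolding filterlim_at_split
    proof
      show "(flat (k + 1) \<longlongrightarrow> 0) (at_left 0)"
        by (rule tendsto_eventually) (auto simp: flat_def eventually_at_left_field intro!: exI[of _ "-1"])
      have "((\<lambda>x::real. inverse x ^ (k + 1) / exp (inverse x)) \<longlongrightarrow> 0) (at_right 0)"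
        by (rule filterlim_compose[OF tendsto_power_div_exp_0 filterlim_inverse_at_top_right])
      moreover have "\<forall>\<^sub>F x in at_right 0. inverse x ^ (k + 1) / exp (inverse x) = flat (k + 1) x"
        using eventually_at_right_less[of "0::real"]
        by (rule eventually_mono) (simp add: flat_def exp_minus divide_inverse)
      ultimately show "(flat (k + 1) \<longlongrightarrow> 0) (at_right 0)"
        by (rule Lim_transform_eventually)
    qed
    moreover have "(flat k (0 + h) - flat k 0) / h = flat (k + 1) h" for h
      by (simp add: flat_def divide_inverse mult_ac)
    ultimately have "(flat k has_real_derivative 0) (at 0)"
      unfolding DERIV_def by simp
    then show ?thesis using 2 by (simp add: flat_def)
  qed
qed

lemma C_infinity_flat: "C_infinity_on UNIV (flat k)"
proof (rule C_infinity_on_lincombs[of "range flat"])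
  show "flat k \<in> lincombs (range flat)" by (intro lincombs_base rangeI)
  fix g assume "g \<in> range flat"
  then obtain k where g: "g = flat k" by blast
  have "(\<lambda>x. flat (k + 2) x + (- real k) *\<^sub>R flat (k + 1) x) \<in> lincombs (range flat)"
    by (rule lincombs_add[OF lincombs_base[OF rangeI] lincombs_scale[OF lincombs_base[OF rangeI]]])
  moreover have "(g has_vector_derivative flat (k + 2) x + (- real k) *\<^sub>R flat (k + 1) x) (at x)" for x
    using flat_derivative[of k x] by (simp add: g has_real_derivative_iff_has_vector_derivative)
  ultimately show "\<exists>g'\<in>lincombs (range flat). \<forall>t\<in>UNIV. (g has_vector_derivative g' t) (at t)"
    by (intro bexI[of _ "\<lambda>x. flat (k + 2) x + (- real k) *\<^sub>R flat (k + 1) x"]) auto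
qed

definition bump :: "real \<Rightarrow> real \<Rightarrow> real \<Rightarrow> real" where
  "bump a b t = flat 0 (t - a) * flat 0 (b - t)"

lemma C_infinity_bump: "C_infinity_on UNIV (bump a b)"
proof -
  have "C_infinity_on UNIV (\<lambda>t. flat 0 (1 * t + (- a)) * flat 0 ((-1) * t + b))"
    by (intro C_infinity_on_mult C_infinity_affine[OF C_infinity_flat])
  moreover have "(\<lambda>t. flat 0 (1 * t + (- a)) * flat 0 ((-1) * t + b)) = bump a b"
    by (auto simp: bump_def)
  ultimately show ?thesis by simp
qed

lemma bump_nonneg: "bump a b t \<ge> 0"
  by (simp add: bump_def flat_def)

lemma bump_pos_iff: "bump a b t > 0 \<longleftrightarrow> a < t \<and> t < b"
  by (auto simp: bump_def flat_def)

lemma bump_eq_0: "t \<notin> {a<..<b} \<Longrightarrow> bump a b t = 0"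
  by (auto simp: bump_def flat_def)

section \<open>The lemma of du Bois-Reymond\<close>

text \<open>An antiderivative of a bump has compact support exactly when the integral of the bump vanishes.\<close>

lemma test_function_antiderivative:
  assumes \<psi>: "C_infinity_on UNIV \<psi>" and ab: "0 < a" "a \<le> b" "b < \<tau>"
    and supp: "\<And>t. t \<notin> {a..b} \<Longrightarrow> \<psi> t = 0" and int: "integral {0..\<tau>} \<psi> = 0"
  obtains \<phi> where "test_function \<tau> \<phi>" "\<And>t. (\<phi> has_real_derivative \<psi> t) (at t)"
proof -
  \<comment> \<open>For \<open>t < 0\<close> the interval is empty, so \<open>\<phi>\<close> is zero there.\<close>
  define \<phi> where "\<phi> t = integral {0..t} \<psi>" for t
  have cont: "continuous_on S \<psi>" for S
    using C_infinity_on_imp_continuous[OF \<psi>] continuous_on_subset by blast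
  have left: "\<phi> t = 0" if "t < a" for t
  proof -
    have "integral {0..t} \<psi> = integral {0..t} (\<lambda>_. 0)"
      by (rule Henstock_Kurzweil_Integration.integral_cong) (use that supp in auto)
    then show ?thesis by (simp add: \<phi>_def)
  qed
  have right: "\<phi> t = 0" if "t > b" for t
  proof -
    have zero: "integral {b..s} \<psi> = 0" for s
      using integral_spike[of "{b}" "{b..s}" "\<lambda>_. 0" \<psi>] supp by auto
    have comb: "\<phi> s = integral {0..b} \<psi>" if "s \<ge> b" for s
      using Henstock_Kurzweil_Integration.integral_combine[of 0 b s \<psi>] ab that zero[of s]
        integrable_continuous_real[OF cont] by (simp add: \<phi>_def)
    show ?thesis using comb[of t] comb[of \<tau>] that ab int by (simp add: \<phi>_def)
  qed
  have deriv: "(\<phi> has_real_derivative \<psi> t) (at t)" for t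
  proof (cases "t < a")
    case True
    have "((\<lambda>_. 0) has_real_derivative 0) (at t)" by simp
    then have "(\<phi> has_real_derivative 0) (at t)"
      by (rule has_field_derivative_transform_within_open[where S = "{..<a}"]) (use True left in auto)
    then show ?thesis using supp[of t] True by simp
  next
    case False
    then have "(\<phi> has_vector_derivative \<psi> t) (at t within {0..t + 1})"
      unfolding \<phi>_def using ab by (intro integral_has_vector_derivative cont) auto
    then show ?thesis using False ab at_within_Icc_at[of 0 t "t + 1"]
      by (simp add: has_real_derivative_iff_has_vector_derivative)
  qed
  obtain D where D: "D 0 = \<psi>" "\<And>n t. (D n has_vector_derivative D (Suc n) t) (at t)"
    using \<psi> unfolding C_infinity_on_def by auto
  have "C_infinity_on UNIV \<phi>"
    unfolding C_infinity_on_def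
    \<comment> \<open>The derivatives of \<open>\<phi>\<close> are those of \<open>\<psi>\<close>, shifted by one.\<close>
    by (intro exI[of _ "case_nat \<phi> D"])
      (use D deriv in \<open>auto simp: has_real_derivative_iff_has_vector_derivative split: nat.split\<close>)
  then have "test_function \<tau> \<phi>"
    unfolding test_function_def using ab left right
    by (intro conjI exI[of _ a] exI[of _ b]) (auto simp: not_le)
  then show thesis using deriv by (rule that)
qed

text \<open>All functions involved extend continuously to the closed interval, up to a null set, so the Lebesgue
integrals of the weak formulation become integrals to which the fundamental theorem of calculus applies.\<close>

lemma weak_derivative_integral_identity:
  fixes v h g :: "real \<Rightarrow> 'a::euclidean_space"
  assumes v: "continuous_on {0..\<tau>} v" and h: "continuous_on {0..\<tau>} h"
    and weak: "has_weak_derivative \<tau> v g"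
    and AE: "AE t in lebesgue_on {0<..<\<tau>}. g t = h t"
    and \<phi>: "test_function \<tau> \<phi>" and \<psi>: "\<And>t. (\<phi> has_real_derivative \<psi> t) (at t)"
    and \<psi>_cont: "continuous_on UNIV \<psi>"
  shows "integral {0..\<tau>} (\<lambda>t. \<psi> t *\<^sub>R v t) = - integral {0..\<tau>} (\<lambda>t. \<phi> t *\<^sub>R h t)"
proof -
  let ?S = "{0<..<\<tau>}"
  have S: "?S \<in> sets lebesgue" by simp
  have open_abs: "k absolutely_integrable_on ?S" if "continuous_on {0..\<tau>} k" for k :: "real \<Rightarrow> 'a"
    using absolutely_integrable_continuous_real[OF that]
    by (rule set_integrable_subset) auto
  have open_int: "integral ?S k = integral {0..\<tau>} k" for k :: "real \<Rightarrow> 'a"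
    by (simp add: integral_open_interval_real)
  have \<phi>_cont: "continuous_on {0..\<tau>} \<phi>"
    using \<psi> by (intro continuous_at_imp_continuous_on) (auto intro: DERIV_isCont)
  have \<psi>v: "continuous_on {0..\<tau>} (\<lambda>t. \<psi> t *\<^sub>R v t)"
    by (intro continuous_intros v continuous_on_subset[OF \<psi>_cont]) auto
  have \<phi>h: "continuous_on {0..\<tau>} (\<lambda>t. \<phi> t *\<^sub>R h t)"
    by (intro continuous_intros h \<phi>_cont)
  define N where "N = {t. \<not> (t \<in> ?S \<longrightarrow> g t = h t)}"
  have "AE t in lebesgue. t \<in> ?S \<longrightarrow> g t = h t"
    using AE by (simp add: AE_restrict_space_iff)
  then have N: "negligible N"
    unfolding completion.AE_iff_null_sets negligible_iff_null_sets N_def by simp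
  have gh: "\<phi> t *\<^sub>R g t = \<phi> t *\<^sub>R h t" if "t \<in> ?S - N" for t
    using that by (auto simp: N_def)
  have "integral {0..\<tau>} (\<lambda>t. \<psi> t *\<^sub>R v t) = (LINT t|lebesgue_on ?S. \<psi> t *\<^sub>R v t)"
    using lebesgue_integral_eq_integral[OF absolutely_integrable_imp_integrable[OF open_abs[OF \<psi>v] S] S]
    by (simp add: open_int)
  also have "\<dots> = (LINT t|lebesgue_on ?S. deriv \<phi> t *\<^sub>R v t)"
    using DERIV_imp_deriv[OF \<psi>] by simp
  also have "\<dots> = - (LINT t|lebesgue_on ?S. \<phi> t *\<^sub>R g t)"
    using weak \<phi> unfolding has_weak_derivative_def by blast
  also have "(LINT t|lebesgue_on ?S. \<phi> t *\<^sub>R g t) = integral ?S (\<lambda>t. \<phi> t *\<^sub>R g t)"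
    using absolutely_integrable_spike[OF open_abs[OF \<phi>h] N gh] S
    by (intro lebesgue_integral_eq_integral absolutely_integrable_imp_integrable)
  also have "\<dots> = integral ?S (\<lambda>t. \<phi> t *\<^sub>R h t)"
    by (rule integral_spike[OF N]) (rule gh[symmetric])
  finally show ?thesis by (simp add: open_int)
qed

text \<open>The difference \<open>w\<close> of \<open>v\<close> and the antiderivative of \<open>h\<close> is orthogonal to every bump of integral zero. Subtracting from an
arbitrary bump the right multiple of one fixed bump \<open>\<psi>0\<close> shows that \<open>w - C\<close> is orthogonal to all bumps,
where \<open>C\<close> is the mean of \<open>w\<close> against \<open>\<psi>0\<close>. A point with \<open>w \<noteq> C\<close> is then refuted by a bump around it.\<close>

lemma du_Bois_Reymond:
  fixes v h g :: "real \<Rightarrow> 'a::euclidean_space"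
  assumes \<tau>: "\<tau> > 0" and v: "continuous_on {0..\<tau>} v" and h: "continuous_on {0..\<tau>} h"
    and weak: "has_weak_derivative \<tau> v g"
    and AE: "AE t in lebesgue_on {0<..<\<tau>}. g t = h t"
    and t: "t \<in> {0..\<tau>}"
  shows "v t = v 0 + integral {0..t} h"
proof -
  define H where "H t = integral {0..t} h" for t
  define w where "w t = v t - H t" for t
  have H: "(H has_vector_derivative h t) (at t within {0..\<tau>})" if "t \<in> {0..\<tau>}" for t
    unfolding H_def by (rule integral_has_vector_derivative[OF h that])
  have H_cont: "continuous_on {0..\<tau>} H"
    unfolding H_def by (rule indefinite_integral_continuous_1[OF integrable_continuous_real[OF h]])
  have w_cont: "continuous_on {0..\<tau>} w"
    unfolding w_def by (intro continuous_intros v H_cont)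
  have orth: "integral {0..\<tau>} (\<lambda>t. \<psi> t *\<^sub>R w t) = 0"
    if \<psi>: "C_infinity_on UNIV \<psi>" and ab: "0 < a" "a \<le> b" "b < \<tau>"
      and supp: "\<And>t. t \<notin> {a..b} \<Longrightarrow> \<psi> t = 0" and int: "integral {0..\<tau>} \<psi> = 0" for \<psi> a b
  proof -
    obtain \<phi> where \<phi>: "test_function \<tau> \<phi>" "\<And>t. (\<phi> has_real_derivative \<psi> t) (at t)"
      using test_function_antiderivative[OF \<psi> ab supp int] by blast
    have \<psi>_cont: "continuous_on S \<psi>" for S
      using C_infinity_on_imp_continuous[OF \<psi>] continuous_on_subset by blast
    have \<phi>_cont: "continuous_on {0..\<tau>} \<phi>"
      using \<phi>(2) by (intro continuous_at_imp_continuous_on) (auto intro: DERIV_isCont)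
    have "((\<lambda>t. \<phi> t *\<^sub>R h t + \<psi> t *\<^sub>R H t) has_integral \<phi> \<tau> *\<^sub>R H \<tau> - \<phi> 0 *\<^sub>R H 0) {0..\<tau>}"
      using \<tau> by (intro fundamental_theorem_of_calculus has_vector_derivative_scaleR
          has_field_derivative_at_within[OF \<phi>(2)] H) auto
    moreover have "\<phi> 0 = 0" "\<phi> \<tau> = 0"
      using \<phi>(1) unfolding test_function_def by fastforce+
    ultimately have "integral {0..\<tau>} (\<lambda>t. \<phi> t *\<^sub>R h t + \<psi> t *\<^sub>R H t) = 0"
      by (simp add: integral_unique)
    moreover have "(\<lambda>t. \<phi> t *\<^sub>R h t) integrable_on {0..\<tau>}" "(\<lambda>t. \<psi> t *\<^sub>R H t) integrable_on {0..\<tau>}"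
      "(\<lambda>t. \<psi> t *\<^sub>R v t) integrable_on {0..\<tau>}"
      by (intro integrable_continuous_real continuous_intros \<phi>_cont \<psi>_cont h H_cont v)+
    ultimately show ?thesis
      using weak_derivative_integral_identity[OF v h weak AE \<phi> \<psi>_cont]
      by (simp add: w_def scaleR_diff_right integral_diff integral_add add_eq_0_iff)
  qed
  have bump_cont: "continuous_on S (bump a b)" for S a b
    using C_infinity_on_imp_continuous[OF C_infinity_bump] continuous_on_subset by blast
  define \<psi>0 where "\<psi>0 = bump (\<tau> / 3) (2 * \<tau> / 3)"
  define m where "m = integral {0..\<tau>} \<psi>0"
  have "m \<noteq> 0"
  proof
    assume "m = 0"
    then have "\<psi>0 (\<tau> / 2) = 0"
      using integral_eq_0_iff[of 0 \<tau> \<psi>0] \<tau> bump_cont bump_nonneg unfolding m_def \<psi>0_def by force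
    moreover have "\<psi>0 (\<tau> / 2) > 0" using \<tau> by (simp add: \<psi>0_def bump_pos_iff)
    ultimately show False by simp
  qed
  define C where "C = (1 / m) *\<^sub>R integral {0..\<tau>} (\<lambda>t. \<psi>0 t *\<^sub>R w t)"
  have bump_orth: "integral {0..\<tau>} (\<lambda>t. bump a b t *\<^sub>R (w t - C)) = 0" if ab: "0 < a" "a < b" "b < \<tau>" for a b
  proof -
    define c where "c = integral {0..\<tau>} (bump a b) / m"
    have ints: "bump a b integrable_on {0..\<tau>}" "\<psi>0 integrable_on {0..\<tau>}"
      "(\<lambda>t. bump a b t *\<^sub>R w t) integrable_on {0..\<tau>}" "(\<lambda>t. \<psi>0 t *\<^sub>R w t) integrable_on {0..\<tau>}"
      unfolding \<psi>0_def
      by (intro integrable_continuous_real continuous_intros bump_cont w_cont)+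
    have "integral {0..\<tau>} (\<lambda>t. (bump a b t + (- c) * \<psi>0 t) *\<^sub>R w t) = 0"
    proof (rule orth[of _ "min a (\<tau> / 3)" "max b (2 * \<tau> / 3)"])
      show "C_infinity_on UNIV (\<lambda>t. bump a b t + (- c) * \<psi>0 t)"
        unfolding \<psi>0_def by (intro C_infinity_on_add C_infinity_on_mult C_infinity_on_const C_infinity_bump)
      show "integral {0..\<tau>} (\<lambda>t. bump a b t + (- c) * \<psi>0 t) = 0"
      proof -
        have "integral {0..\<tau>} (\<lambda>t. bump a b t + (- c) * \<psi>0 t) = integral {0..\<tau>} (bump a b) + (- c) * m"
          by (simp only: Henstock_Kurzweil_Integration.integral_add integrable_on_mult_right ints(1,2)
              Henstock_Kurzweil_Integration.integral_mult_right m_def)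
        then show ?thesis using \<open>m \<noteq> 0\<close> by (simp add: c_def)
      qed
      show "bump a b t + (- c) * \<psi>0 t = 0" if "t \<notin> {min a (\<tau> / 3)..max b (2 * \<tau> / 3)}" for t
      proof -
        have "t \<notin> {a<..<b}" "t \<notin> {\<tau> / 3<..<2 * \<tau> / 3}" using that by auto
        then show ?thesis by (simp add: \<psi>0_def bump_eq_0)
      qed
    qed (use ab \<tau> in auto)
    then have "integral {0..\<tau>} (\<lambda>t. bump a b t *\<^sub>R w t - c *\<^sub>R (\<psi>0 t *\<^sub>R w t)) = 0"
      by (simp add: algebra_simps)
    then have "integral {0..\<tau>} (\<lambda>t. bump a b t *\<^sub>R w t) = c *\<^sub>R integral {0..\<tau>} (\<lambda>t. \<psi>0 t *\<^sub>R w t)"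
      using ints(3) integrable_cmul[OF ints(4), of c] by (simp add: integral_diff del: scaleR_scaleR)
    also have "\<dots> = integral {0..\<tau>} (bump a b) *\<^sub>R C"
      by (simp add: c_def C_def)
    also have "\<dots> = integral {0..\<tau>} (\<lambda>t. bump a b t *\<^sub>R C)"
      using integral_linear[OF ints(1) bounded_linear_scaleR_left[of C]] by (simp add: o_def)
    finally show ?thesis
      using ints(3) integrable_on_scaleR_left[OF ints(1), of C]
      by (simp add: scaleR_diff_right integral_diff)
  qed
  have "w s = C" if s: "s \<in> {0<..<\<tau>}" for s
  proof (rule ccontr)
    assume "w s \<noteq> C"
    define e where "e = w s - C"
    define k where "k t = (w t - C) \<bullet> e" for t
    have "k s > 0" using \<open>w s \<noteq> C\<close> by (simp add: k_def e_def)
    have k_cont: "continuous_on {0..\<tau>} k"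
      unfolding k_def by (intro continuous_intros w_cont)
    then have "continuous_on {0<..<\<tau>} k" by (rule continuous_on_subset) auto
    then have "isCont k s" using s continuous_on_eq_continuous_at[of "{0<..<\<tau>}" k] by simp
    then have "\<forall>\<^sub>F t in at s. k t > 0"
      using \<open>k s > 0\<close> unfolding isCont_def by (rule order_tendstoD)
    then obtain d where d: "d > 0" "\<And>t. t \<noteq> s \<Longrightarrow> dist t s < d \<Longrightarrow> k t > 0"
      unfolding eventually_at by blast
    define r where "r = min d (min s (\<tau> - s)) / 2"
    have r: "r > 0" "r < d" "r < s" "r < \<tau> - s" using d(1) s by (auto simp: r_def)
    define B where "B = bump (s - r) (s + r)"
    have Bk_nonneg: "B t * k t \<ge> 0" for t
    proof (cases "t \<in> {s - r<..<s + r}")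
      case True
      then have "k t > 0"
        using d(2)[of t] \<open>k s > 0\<close> r by (cases "t = s") (auto simp: dist_real_def abs_less_iff)
      then show ?thesis using bump_nonneg by (simp add: B_def)
    next
      case False then show ?thesis by (simp add: B_def bump_eq_0)
    qed
    have cont: "continuous_on {0..\<tau>} (\<lambda>t. B t * k t)"
      unfolding B_def by (intro continuous_intros bump_cont k_cont)
    have "(\<lambda>t. B t *\<^sub>R (w t - C)) integrable_on {0..\<tau>}"
      unfolding B_def by (intro integrable_continuous_real continuous_intros bump_cont w_cont)
    from integral_linear[OF this bounded_linear_inner_left[of e]]
    have "integral {0..\<tau>} (\<lambda>t. B t * k t) = integral {0..\<tau>} (\<lambda>t. B t *\<^sub>R (w t - C)) \<bullet> e"
      by (simp add: o_def k_def)
    also have "\<dots> = 0" using bump_orth[of "s - r" "s + r"] r by (simp add: B_def)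
    finally have "B s * k s = 0"
      using integral_eq_0_iff[OF cont \<tau> Bk_nonneg] s by auto
    moreover have "B s > 0" using r by (simp add: B_def bump_pos_iff)
    ultimately show False using \<open>k s > 0\<close> by simp
  qed
  then have "w s = C" if "s \<in> {0..\<tau>}" for s
    using continuous_constant_on_closure[of "{0<..<\<tau>}" w C s] w_cont that \<tau> by simp
  then have "w t = w 0" using t \<tau> by simp
  then show ?thesis by (simp add: w_def H_def algebra_simps)
qed

section \<open>Integrals of rapidly oscillating functions\<close>

lemma continuous_on_Icc_bounded:
  fixes h :: "real \<Rightarrow> 'a::real_normed_vector"
  assumes "continuous_on {a..b} h"
  obtains M where "M \<ge> 0" "\<And>t. t \<in> {a..b} \<Longrightarrow> norm (h t) \<le> M"
proof -
  have "bounded (h ` {a..b})"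
    by (intro compact_imp_bounded compact_continuous_image assms) simp
  then obtain M where "\<forall>y\<in>h ` {a..b}. norm y \<le> M" unfolding bounded_iff by blast
  with that[of "max 0 M"] show thesis by force
qed

text \<open>A form of the Riemann-Lebesgue lemma, uniform in the oscillating factor \<open>s\<close>: it depends on \<open>s\<close> only
through a bound on \<open>s\<close> and a bound on an antiderivative \<open>S\<close>. The function \<open>h\<close> is replaced by a polynomial,
for which integration by parts moves the derivative away from \<open>S\<close>.\<close>

lemma oscillating_integral_small:
  fixes h :: "real \<Rightarrow> 'a::euclidean_space"
  assumes \<tau>: "\<tau> \<ge> 0" and h: "continuous_on {0..\<tau>} h" and e: "e > 0"
  obtains c where "c > 0"
    and "\<And>s S t. \<lbrakk>continuous_on {0..\<tau>} s; \<And>r. (S has_real_derivative s r) (at r);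
        \<And>r. \<bar>s r\<bar> \<le> 2; \<And>r. \<bar>S r\<bar> \<le> c; t \<in> {0..\<tau>}\<rbrakk>
      \<Longrightarrow> norm (integral {0..t} (\<lambda>r. s r *\<^sub>R h r)) \<le> e"
proof -
  define d where "d = e / (4 * (\<tau> + 1))"
  have d: "d > 0" using \<tau> e by (simp add: d_def)
  obtain p where p: "polynomial_function p" "\<And>t. t \<in> {0..\<tau>} \<Longrightarrow> norm (h t - p t) < d"
    using Stone_Weierstrass_polynomial_function[OF _ h d] by auto
  obtain p' where p': "polynomial_function p'" "\<And>t. (p has_vector_derivative p' t) (at t)"
    using has_vector_derivative_polynomial_function[OF p(1)] by blast
  have contp: "continuous_on S p" "continuous_on S p'" for S
    using p(1) p'(1) by (auto intro: continuous_on_polymonial_function)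
  obtain M where M0: "M \<ge> 0" and M: "\<And>t. t \<in> {0..\<tau>} \<Longrightarrow> norm (p t) \<le> M"
    using continuous_on_Icc_bounded[OF contp(1)] by blast
  obtain M' where M0': "M' \<ge> 0" and M': "\<And>t. t \<in> {0..\<tau>} \<Longrightarrow> norm (p' t) \<le> M'"
    using continuous_on_Icc_bounded[OF contp(2)] by blast
  note M0 = M0 M0'
  define Q where "Q = 2 * M + \<tau> * M' + 1"
  define c where "c = e / (2 * Q)"
  have den: "Q > 0" unfolding Q_def using M0 \<tau> by (simp add: add_nonneg_pos)
  show thesis
  proof (rule that[of c])
    show "c > 0" using den e by (simp add: c_def)
    fix s S t assume s: "continuous_on {0..\<tau>} s" and S: "\<And>r. (S has_real_derivative s r) (at r)"
      and s2: "\<And>r. \<bar>s r\<bar> \<le> (2::real)" and Sc: "\<And>r. \<bar>S r\<bar> \<le> c" and t: "t \<in> {0..\<tau>}"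
    have sub: "{0..t} \<subseteq> {0..\<tau>}" using t by auto
    have st: "continuous_on {0..t} s" "continuous_on {0..t} h"
      using s h sub by (auto intro: continuous_on_subset)
    have S_cont: "continuous_on {0..t} S"
      using S by (intro continuous_at_imp_continuous_on) (auto intro: DERIV_isCont)
    have int: "(\<lambda>r. s r *\<^sub>R p r) integrable_on {0..t}" "(\<lambda>r. s r *\<^sub>R (h r - p r)) integrable_on {0..t}"
      "(\<lambda>r. S r *\<^sub>R p' r) integrable_on {0..t}"
      by (intro integrable_continuous_real continuous_intros st contp S_cont)+
    have 1: "norm (integral {0..t} (\<lambda>r. s r *\<^sub>R (h r - p r))) \<le> e / 2"
    proof -
      have "norm (integral {0..t} (\<lambda>r. s r *\<^sub>R (h r - p r))) \<le> integral {0..t} (\<lambda>_. 2 * d)"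
      proof (rule integral_norm_bound_integral[OF int(2)])
        show "norm (s r *\<^sub>R (h r - p r)) \<le> 2 * d" if "r \<in> {0..t}" for r
          using s2[of r] p(2)[of r] that sub by (auto intro!: mult_mono)
      qed auto
      also have "\<dots> = 2 * d * t" using t by simp
      also have "\<dots> \<le> 2 * d * (\<tau> + 1)" using t d by (intro mult_left_mono) auto
      also have "\<dots> = e / 2" using \<tau> by (simp add: d_def divide_simps)
      finally show ?thesis .
    qed
    have "((\<lambda>r. S r *\<^sub>R p' r + s r *\<^sub>R p r) has_integral S t *\<^sub>R p t - S 0 *\<^sub>R p 0) {0..t}"
      using t by (intro fundamental_theorem_of_calculus has_vector_derivative_scaleR
          has_field_derivative_at_within[OF S] has_vector_derivative_at_within[OF p'(2)]) auto
    then have parts: "integral {0..t} (\<lambda>r. s r *\<^sub>R p r) = S t *\<^sub>R p t - S 0 *\<^sub>R p 0 - integral {0..t} (\<lambda>r. S r *\<^sub>R p' r)"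
      using int by (simp add: has_integral_iff Henstock_Kurzweil_Integration.integral_add algebra_simps)
    have "norm (integral {0..t} (\<lambda>r. S r *\<^sub>R p' r)) \<le> integral {0..t} (\<lambda>_. c * M')"
    proof (rule integral_norm_bound_integral[OF int(3)])
      show "norm (S r *\<^sub>R p' r) \<le> c * M'" if "r \<in> {0..t}" for r
        using Sc[of r] M'[of r] that sub M0 by (auto intro!: mult_mono)
    qed auto
    also have "\<dots> = c * M' * t" using t by simp
    also have "\<dots> \<le> c * M' * \<tau>" using t M0 \<open>c > 0\<close> by (intro mult_left_mono) auto
    finally have a: "norm (integral {0..t} (\<lambda>r. S r *\<^sub>R p' r)) \<le> c * M' * \<tau>" .
    have b: "norm (S r *\<^sub>R p r) \<le> c * M" if "r \<in> {0..\<tau>}" for r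
      using Sc[of r] M[of r] that M0 by (auto intro!: mult_mono)
    have "norm (integral {0..t} (\<lambda>r. s r *\<^sub>R p r)) \<le> c * M + c * M + c * M' * \<tau>"
      unfolding parts using a b[OF t] b[of 0] \<tau>
      by (intro order_trans[OF norm_triangle_ineq4 add_mono[OF order_trans[OF norm_triangle_ineq4 add_mono]]]) auto
    also have "\<dots> \<le> c * Q" using \<open>c > 0\<close> by (simp add: Q_def algebra_simps)
    also have "\<dots> = e / 2" using den by (simp add: c_def)
    finally have 2: "norm (integral {0..t} (\<lambda>r. s r *\<^sub>R p r)) \<le> e / 2" .
    have "integral {0..t} (\<lambda>r. s r *\<^sub>R h r)
        = integral {0..t} (\<lambda>r. s r *\<^sub>R p r + s r *\<^sub>R (h r - p r))"
      by (simp flip: scaleR_right_distrib)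
    also have "\<dots> = integral {0..t} (\<lambda>r. s r *\<^sub>R p r) + integral {0..t} (\<lambda>r. s r *\<^sub>R (h r - p r))"
      by (rule Henstock_Kurzweil_Integration.integral_add[OF int(1,2)])
    finally show "norm (integral {0..t} (\<lambda>r. s r *\<^sub>R h r)) \<le> e"
      using norm_triangle_mono[OF 2 1] by simp
  qed
qed

lemma norm_integral_le_sup:
  fixes h :: "real \<Rightarrow> 'a::euclidean_space"
  assumes h: "continuous_on {0..\<tau>} h" and le: "\<And>s. s \<in> {0..\<tau>} \<Longrightarrow> norm (h s) \<le> c" and t: "t \<in> {0..\<tau>}"
  shows "norm (integral {0..t} h) \<le> c * \<tau>"
proof -
  have "norm (integral {0..t} h) \<le> integral {0..t} (\<lambda>_. c)"
    using t by (intro integral_norm_bound_integral integrable_continuous_real continuous_on_subset[OF h] le) auto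
  also have "\<dots> = c * t" using t by simp
  also have "\<dots> \<le> c * \<tau>"
    using t order_trans[OF norm_ge_zero le[OF t]] by (intro mult_left_mono) auto
  finally show ?thesis .
qed

section \<open>The coupled system and its averaged form\<close>

locale coupled_system =
  fixes A :: "'x::euclidean_space \<Rightarrow> 'x" and f :: "'x \<Rightarrow> 'x" and \<Gamma> :: "'x \<Rightarrow> 'x \<Rightarrow> 'x"
    and \<Gamma>' :: "'z::euclidean_space \<Rightarrow> 'x \<Rightarrow> 'z" and F :: "'z \<Rightarrow> 'z"
    and \<tau> :: real and x0 :: 'x and z0 :: 'z
  assumes A: "linear A" and \<Gamma>: "bilinear \<Gamma>" and \<Gamma>_sym: "\<Gamma> x y = \<Gamma> y x" and f: "f x = \<Gamma> x x"
    and \<Gamma>': "bilinear \<Gamma>'" and F: "local_lipschitz (UNIV :: real set) UNIV (\<lambda>_. F)"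
    and \<tau>: "\<tau> > 0"
begin

abbreviation trajectory :: "(real \<Rightarrow> 'x) \<Rightarrow> (real \<Rightarrow> 'x) \<Rightarrow> (real \<Rightarrow> 'z) \<Rightarrow> bool" where
  "trajectory \<equiv> solves_coupled_system \<tau> A f (\<lambda>v. v) \<Gamma>' F x0 z0"

text \<open>The right-hand side of the system for the pair \<open>(v, w)\<close> when \<open>v + \<zeta>\<close> is the first component of the
state; \<open>\<zeta> = 0\<close> gives the system itself. The derivative of \<open>\<zeta>\<close> does not occur, which is why \<open>v\<close> can
converge although \<open>\<zeta>\<close> oscillates ever faster.\<close>

definition vfield :: "(real \<Rightarrow> 'x) \<Rightarrow> (real \<Rightarrow> 'x) \<Rightarrow> real \<Rightarrow> 'x \<times> 'z \<Rightarrow> 'x \<times> 'z" where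
  "vfield g \<zeta> t p = (g t - A (fst p + \<zeta> t) - f (fst p + \<zeta> t), - \<Gamma>' (snd p) (fst p + \<zeta> t) - F (snd p))"

lemma f_diff: "f a - f b = \<Gamma> (a - b) (a + b)"
  by (simp add: f bilinear_lsub[OF \<Gamma>] bilinear_radd[OF \<Gamma>] \<Gamma>_sym[of b a])

lemma F_lipschitz: obtains L where "L \<ge> 0"
    "\<And>y z. norm y \<le> R \<Longrightarrow> norm z \<le> R \<Longrightarrow> norm (F y - F z) \<le> L * norm (y - z)"
proof -
  have "local_lipschitz {0::real} (cball 0 R) (\<lambda>_. F)"
    by (rule local_lipschitz_subset[OF F]) auto
  then obtain L where L: "L-lipschitz_on (cball 0 R) F"
    by (rule local_lipschitz_compact_implies_lipschitz) auto
  show thesis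
    by (rule that[OF lipschitz_on_nonneg[OF L]]) (use lipschitz_on_normD[OF L] in auto)
qed

lemma continuous_on_f:
  fixes a :: "real \<Rightarrow> 'x"
  shows "continuous_on S a \<Longrightarrow> continuous_on S (\<lambda>t. f (a t))"
  unfolding f by (intro bilinear_continuous_on_compose[OF _ _ \<Gamma>])

lemma continuous_on_F:
  fixes a :: "real \<Rightarrow> 'z"
  shows "continuous_on S a \<Longrightarrow> continuous_on S (\<lambda>t. F (a t))"
  using continuous_on_compose2[OF local_lipschitz_continuous_on[OF F UNIV_I], of S a] by simp

lemma vfield_continuous:
  fixes S :: "real set"
  assumes "continuous_on S g" "continuous_on S \<zeta>" "continuous_on S p"
  shows "continuous_on S (\<lambda>t. vfield g \<zeta> t (p t))"
  unfolding vfield_def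
  by (intro continuous_intros assms continuous_on_f continuous_on_F
      linear_continuous_on_compose[OF _ A] bilinear_continuous_on_compose[OF _ _ \<Gamma>'])

text \<open>A Lipschitz constant on the ball of radius \<open>R\<close> that serves all forcings \<open>g\<close> and all \<open>\<zeta>\<close> bounded by \<open>R\<close> at
once. The frequency of \<open>\<zeta>\<close> can thus be chosen after the constant.\<close>

definition lipschitz_const :: "real \<Rightarrow> real \<Rightarrow> bool" where
  "lipschitz_const R L \<longleftrightarrow> L \<ge> 0 \<and>
    (\<forall>g \<zeta> t p q. norm (\<zeta> t) \<le> R \<longrightarrow> norm p \<le> R \<longrightarrow> norm q \<le> R
      \<longrightarrow> norm (vfield g \<zeta> t p - vfield g \<zeta> t q) \<le> L * norm (p - q))"

lemma lipschitz_const_exists: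
  assumes R: "R \<ge> 0"
  obtains L where "lipschitz_const R L"
proof -
  obtain a where a: "a > 0" "\<And>x. norm (A x) \<le> a * norm x"
    using linear_bounded_pos[OF A] by blast
  obtain b where b: "b > 0" "\<And>x y. norm (\<Gamma> x y) \<le> b * norm x * norm y"
    using bilinear_bounded_pos[OF \<Gamma>] by blast
  obtain c where c: "c > 0" "\<And>x y. norm (\<Gamma>' x y) \<le> c * norm x * norm y"
    using bilinear_bounded_pos[OF \<Gamma>'] by blast
  obtain l where l: "l \<ge> 0" "\<And>y z. norm y \<le> R \<Longrightarrow> norm z \<le> R \<Longrightarrow> norm (F y - F z) \<le> l * norm (y - z)"
    using F_lipschitz[of R] by blast
  have "lipschitz_const R (a + b * (4 * R) + (c * (2 * R) + c * R + l))"
    unfolding lipschitz_const_def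
  proof (intro conjI allI impI)
    show "a + b * (4 * R) + (c * (2 * R) + c * R + l) \<ge> 0" using a b c l R by simp
    fix g \<zeta> :: "real \<Rightarrow> 'x" and t :: real and p q :: "'x \<times> 'z"
    assume \<zeta>: "norm (\<zeta> t) \<le> R" and p: "norm p \<le> R" and q: "norm q \<le> R"
    define v w v' w' where "v = fst p" and "w = snd p" and "v' = fst q" and "w' = snd q"
    define d where "d = norm (p - q)"
    have R4: "norm v \<le> R" "norm w \<le> R" "norm v' \<le> R" "norm w' \<le> R"
      using p q norm_fst_le[of v w] norm_fst_le[of v' w'] norm_snd_le[of w v] norm_snd_le[of w' v']
      by (auto simp: v_def w_def v'_def w'_def)
    have d: "norm (v - v') \<le> d" "norm (w - w') \<le> d" "d \<ge> 0"
      using norm_fst_le[of "v - v'" "w - w'"] norm_snd_le[of "w - w'" "v - v'"]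
      by (auto simp: v_def w_def v'_def w'_def d_def minus_prod_def)
    have A1: "norm (A (v + \<zeta> t) - A (v' + \<zeta> t)) \<le> a * d"
    proof -
      have "A (v + \<zeta> t) - A (v' + \<zeta> t) = A (v - v')" by (simp flip: linear_diff[OF A])
      then show ?thesis using a(2)[of "v - v'"] d(1) a(1) by (smt (verit) mult_left_mono)
    qed
    have f1: "norm (f (v + \<zeta> t) - f (v' + \<zeta> t)) \<le> b * (4 * R) * d"
    proof -
      have "f (v + \<zeta> t) - f (v' + \<zeta> t) = \<Gamma> (v - v') ((v + \<zeta> t) + (v' + \<zeta> t))"
        by (simp add: f_diff)
      moreover have "norm ((v + \<zeta> t) + (v' + \<zeta> t)) \<le> 4 * R"
        using norm_triangle_mono[OF norm_triangle_mono[OF R4(1) \<zeta>] norm_triangle_mono[OF R4(3) \<zeta>]] by simp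
      ultimately have "norm (f (v + \<zeta> t) - f (v' + \<zeta> t)) \<le> b * d * (4 * R)"
        using b d by (auto intro!: order_trans[OF b(2)] mult_mono)
      then show ?thesis by (simp add: mult_ac)
    qed
    have g1: "norm (\<Gamma>' w (v + \<zeta> t) - \<Gamma>' w' (v' + \<zeta> t)) \<le> c * (2 * R) * d + c * R * d"
    proof -
      have e: "\<Gamma>' w (v + \<zeta> t) - \<Gamma>' w' (v' + \<zeta> t) = \<Gamma>' (w - w') (v + \<zeta> t) + \<Gamma>' w' (v - v')"
        by (simp add: bilinear_lsub[OF \<Gamma>'] bilinear_rsub[OF \<Gamma>'] bilinear_radd[OF \<Gamma>'])
      have "norm (v + \<zeta> t) \<le> 2 * R" using norm_triangle_mono[OF R4(1) \<zeta>] by simp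
      then have "norm (\<Gamma>' (w - w') (v + \<zeta> t)) \<le> c * d * (2 * R)"
        using c d by (auto intro!: order_trans[OF c(2)] mult_mono)
      moreover have "norm (\<Gamma>' w' (v - v')) \<le> c * R * d"
        using c d R R4 by (auto intro!: order_trans[OF c(2)] mult_mono)
      ultimately show ?thesis unfolding e
        by (intro norm_triangle_mono) (auto simp: mult_ac)
    qed
    have F1: "norm (F w - F w') \<le> l * d"
      using l(2)[OF R4(2,4)] d(2) l(1) by (smt (verit) mult_left_mono)
    have "vfield g \<zeta> t p - vfield g \<zeta> t q
      = (- (A (v + \<zeta> t) - A (v' + \<zeta> t)) - (f (v + \<zeta> t) - f (v' + \<zeta> t)),
         - (\<Gamma>' w (v + \<zeta> t) - \<Gamma>' w' (v' + \<zeta> t)) - (F w - F w'))"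
      by (simp add: vfield_def v_def w_def v'_def w'_def)
    also have "norm \<dots> \<le> norm (- (A (v + \<zeta> t) - A (v' + \<zeta> t)) - (f (v + \<zeta> t) - f (v' + \<zeta> t)))
        + norm (- (\<Gamma>' w (v + \<zeta> t) - \<Gamma>' w' (v' + \<zeta> t)) - (F w - F w'))"
      by (rule norm_Pair_le)
    also have "\<dots> \<le> (a * d + b * (4 * R) * d) + ((c * (2 * R) * d + c * R * d) + l * d)"
      using A1 f1 g1 F1
      by (intro add_mono order_trans[OF norm_triangle_ineq4 add_mono]) (simp_all only: norm_minus_cancel)
    finally show "norm (vfield g \<zeta> t p - vfield g \<zeta> t q)
        \<le> (a + b * (4 * R) + (c * (2 * R) + c * R + l)) * norm (p - q)"
      by (simp add: d_def algebra_simps)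
  qed
  then show thesis by (rule that)
qed

lemma trajectory_vfield:
  "trajectory g x z \<longleftrightarrow> x 0 = x0 \<and> z 0 = z0 \<and>
    (\<forall>t\<in>{0..\<tau>}. ((\<lambda>t. (x t, z t)) has_vector_derivative vfield g (\<lambda>_. 0) t (x t, z t)) (at t within {0..\<tau>}))"
proof -
  have "((\<lambda>t. (x t, z t)) has_vector_derivative (a, b)) (at t within S) \<longleftrightarrow>
    (x has_vector_derivative a) (at t within S) \<and> (z has_vector_derivative b) (at t within S)" for a b t S
  proof
    assume *: "((\<lambda>t. (x t, z t)) has_vector_derivative (a, b)) (at t within S)"
    show "(x has_vector_derivative a) (at t within S) \<and> (z has_vector_derivative b) (at t within S)"
      using bounded_linear.has_vector_derivative[OF bounded_linear_fst *]
        bounded_linear.has_vector_derivative[OF bounded_linear_snd *] by simp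
  qed (auto intro: has_vector_derivative_Pair)
  then show ?thesis unfolding solves_coupled_system_def vfield_def by auto
qed

lemma trajectory_continuous:
  assumes "trajectory g x z"
  shows "continuous_on {0..\<tau>} x" "continuous_on {0..\<tau>} z"
  using assms unfolding solves_coupled_system_def continuous_on_eq_continuous_within
  by (auto intro: has_vector_derivative_continuous)

lemma trajectory_integral:
  assumes "trajectory g x z" "t \<in> {0..\<tau>}"
  shows "((\<lambda>s. vfield g (\<lambda>_. 0) s (x s, z s)) has_integral (x t, z t) - (x0, z0)) {0..t}"
proof -
  have "((\<lambda>s. vfield g (\<lambda>_. 0) s (x s, z s)) has_integral (x t, z t) - (x 0, z 0)) {0..t}"
  proof (rule fundamental_theorem_of_calculus)
    fix s assume "s \<in> {0..t}"
    then have "((\<lambda>t. (x t, z t)) has_vector_derivative vfield g (\<lambda>_. 0) s (x s, z s)) (at s within {0..\<tau>})"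
      using assms by (simp add: trajectory_vfield)
    then show "((\<lambda>t. (x t, z t)) has_vector_derivative vfield g (\<lambda>_. 0) s (x s, z s)) (at s within {0..t})"
      by (rule has_vector_derivative_within_subset) (use assms(2) in auto)
  qed (use assms(2) in simp)
  then show ?thesis using assms(1) by (simp add: trajectory_vfield)
qed

text \<open>Two solutions on a compact interval stay in a ball, where the field is Lipschitz; Gronwall's inequality
with \<open>\<delta> = 0\<close> applies.\<close>

lemma trajectory_unique:
  assumes xz: "trajectory g x z" and yw: "trajectory g y w" and t: "t \<in> {0..\<tau>}"
  shows "x t = y t \<and> z t = w t"
proof -
  let ?p = "\<lambda>t. (x t, z t)" and ?q = "\<lambda>t. (y t, w t)"
  have cont: "continuous_on {0..\<tau>} ?p" "continuous_on {0..\<tau>} ?q"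
    by (intro continuous_intros trajectory_continuous[OF xz] trajectory_continuous[OF yw])+
  obtain M where M: "M \<ge> 0" "\<And>t. t \<in> {0..\<tau>} \<Longrightarrow> norm (?p t) \<le> M"
    using continuous_on_Icc_bounded[OF cont(1)] by blast
  obtain M' where M': "M' \<ge> 0" "\<And>t. t \<in> {0..\<tau>} \<Longrightarrow> norm (?q t) \<le> M'"
    using continuous_on_Icc_bounded[OF cont(2)] by blast
  define R where "R = max M M'"
  have R: "R \<ge> 0" "\<And>t. t \<in> {0..\<tau>} \<Longrightarrow> norm (?p t) \<le> R" "\<And>t. t \<in> {0..\<tau>} \<Longrightarrow> norm (?q t) \<le> R"
    using M M' unfolding R_def by (auto intro: max.coboundedI1 max.coboundedI2)
  obtain L where "lipschitz_const R L" using lipschitz_const_exists[OF R(1)] .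
  then have L: "L \<ge> 0" and lip: "\<And>s p q. norm p \<le> R \<Longrightarrow> norm q \<le> R
      \<Longrightarrow> norm (vfield g (\<lambda>_. 0) s p - vfield g (\<lambda>_. 0) s q) \<le> L * norm (p - q)"
    using R(1) unfolding lipschitz_const_def by auto
  have "norm (?p t - ?q t) \<le> 0 * exp (L * t)"
  proof (rule gronwall[OF _ L _ t])
    show "continuous_on {0..\<tau>} (\<lambda>t. norm (?p t - ?q t))" by (intro continuous_on_norm continuous_on_diff cont)
    fix t assume t: "t \<in> {0..\<tau>}"
    have "((\<lambda>s. vfield g (\<lambda>_. 0) s (?p s) - vfield g (\<lambda>_. 0) s (?q s)) has_integral
        ((?p t - (x0, z0)) - (?q t - (x0, z0)))) {0..t}"
      by (intro has_integral_diff trajectory_integral[OF _ t] xz yw)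
    then have I: "((\<lambda>s. vfield g (\<lambda>_. 0) s (?p s) - vfield g (\<lambda>_. 0) s (?q s)) has_integral ?p t - ?q t) {0..t}"
      by simp
    have cont': "continuous_on {0..t} (\<lambda>t. L * norm (?p t - ?q t))"
      by (intro continuous_on_mult continuous_on_const continuous_on_norm continuous_on_diff
          continuous_on_subset[OF cont(1)] continuous_on_subset[OF cont(2)]) (use t in auto)
    have "norm (integral {0..t} (\<lambda>s. vfield g (\<lambda>_. 0) s (?p s) - vfield g (\<lambda>_. 0) s (?q s)))
        \<le> integral {0..t} (\<lambda>s. L * norm (?p s - ?q s))"
      by (intro integral_norm_bound_integral has_integral_integrable[OF I]
          integrable_continuous_real[OF cont'] lip) (use R t in auto)
    then show "norm (?p t - ?q t) \<le> 0 + L * integral {0..t} (\<lambda>s. norm (?p s - ?q s))"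
      using integral_unique[OF I] by simp
  qed
  then show ?thesis by (simp add: zero_prod_def)
qed

text \<open>The radius is \<open>R + 1\<close> since the tube of radius 1 around \<open>(x, z)\<close> has to fit into the ball.\<close>

lemma oscillating_solution_near_approximate_solution:
  assumes L: "lipschitz_const (R + 1) L"
    and cont: "continuous_on {0..\<tau>} g" "continuous_on {0..\<tau>} \<zeta>"
      "continuous_on {0..\<tau>} x" "continuous_on {0..\<tau>} z"
    and \<zeta>R: "\<And>t. t \<in> {0..\<tau>} \<Longrightarrow> norm (\<zeta> t) \<le> R"
    and pR: "\<And>t. t \<in> {0..\<tau>} \<Longrightarrow> norm (x t, z t) \<le> R"
    and defect: "\<And>t. t \<in> {0..\<tau>} \<Longrightarrow>
      norm ((x t, z t) - (x 0, z 0) - integral {0..t} (\<lambda>s. vfield g \<zeta> s (x s, z s))) \<le> \<delta>"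
    and small: "\<delta> * exp (L * \<tau>) \<le> 1"
  obtains v w where "v 0 = x 0" and "w 0 = z 0"
    and "\<And>t. t \<in> {0..\<tau>} \<Longrightarrow>
      (v has_vector_derivative g t - A (v t + \<zeta> t) - f (v t + \<zeta> t)) (at t within {0..\<tau>})"
    and "\<And>t. t \<in> {0..\<tau>} \<Longrightarrow>
      (w has_vector_derivative - \<Gamma>' (w t) (v t + \<zeta> t) - F (w t)) (at t within {0..\<tau>})"
    and "\<And>t. t \<in> {0..\<tau>} \<Longrightarrow> norm (v t - x t) \<le> \<delta> * exp (L * \<tau>)"
    and "\<And>t. t \<in> {0..\<tau>} \<Longrightarrow> norm (w t - z t) \<le> \<delta> * exp (L * \<tau>)"
proof -
  have L0: "L \<ge> 0" and lip: "\<And>s q r. norm (\<zeta> s) \<le> R + 1 \<Longrightarrow> norm q \<le> R + 1 \<Longrightarrow> norm r \<le> R + 1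
      \<Longrightarrow> norm (vfield g \<zeta> s q - vfield g \<zeta> s r) \<le> L * norm (q - r)"
    using L unfolding lipschitz_const_def by blast+
  have pc: "continuous_on {0..\<tau>} (\<lambda>t. (x t, z t))" by (intro continuous_intros cont)
  have ball: "norm q \<le> R + 1" if "t \<in> {0..\<tau>}" "q \<in> cball (x t, z t) 1" for t q
  proof -
    have "norm q \<le> norm (x t, z t) + norm (q - (x t, z t))" by (metis norm_triangle_sub)
    then show ?thesis using pR[OF that(1)] that(2) by (simp add: dist_norm norm_minus_commute)
  qed
  obtain q where q: "q 0 = (x 0, z 0)"
    "\<And>t. t \<in> {0..\<tau>} \<Longrightarrow> (q has_vector_derivative vfield g \<zeta> t (q t)) (at t within {0..\<tau>})"
    "\<And>t. t \<in> {0..\<tau>} \<Longrightarrow> norm (q t - (x t, z t)) \<le> \<delta> * exp (L * \<tau>)"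
  proof (rule solution_near_approximate_solution[where p = "\<lambda>t. (x t, z t)" and K = "vfield g \<zeta>",
        OF _ L0 pc _ _ defect small])
    show "0 \<le> \<tau>" using \<tau> by simp
    show "continuous_on {0..\<tau>} (\<lambda>s. vfield g \<zeta> s (q s))" if "continuous_on {0..\<tau>} q" for q
      by (intro vfield_continuous cont that)
    show "norm (vfield g \<zeta> s q - vfield g \<zeta> s r) \<le> L * norm (q - r)"
      if "s \<in> {0..\<tau>}" "q \<in> cball (x s, z s) 1" "r \<in> cball (x s, z s) 1" for s q r
      using \<zeta>R[OF that(1)] ball[OF that(1)] that by (intro lip) auto
  qed auto
  show thesis
  proof (rule that[of "\<lambda>t. fst (q t)" "\<lambda>t. snd (q t)"])
    show "fst (q 0) = x 0" "snd (q 0) = z 0" using q(1) by auto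
    fix t assume t: "t \<in> {0..\<tau>}"
    show "((\<lambda>t. fst (q t)) has_vector_derivative g t - A (fst (q t) + \<zeta> t) - f (fst (q t) + \<zeta> t)) (at t within {0..\<tau>})"
      using bounded_linear.has_vector_derivative[OF bounded_linear_fst q(2)[OF t]] by (simp add: vfield_def)
    show "((\<lambda>t. snd (q t)) has_vector_derivative - \<Gamma>' (snd (q t)) (fst (q t) + \<zeta> t) - F (snd (q t))) (at t within {0..\<tau>})"
      using bounded_linear.has_vector_derivative[OF bounded_linear_snd q(2)[OF t]] by (simp add: vfield_def)
    show "norm (fst (q t) - x t) \<le> \<delta> * exp (L * \<tau>)" "norm (snd (q t) - z t) \<le> \<delta> * exp (L * \<tau>)"
      using q(3)[OF t] norm_fst_le[of "fst (q t) - x t" "snd (q t) - z t"]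
        norm_snd_le[of "snd (q t) - z t" "fst (q t) - x t"]
      by (auto simp: minus_prod_def intro: order_trans)
  qed
qed

section \<open>Replacing a quadratic forcing by an oscillation\<close>

text \<open>The three quantities of the approximation theorem, each bounded by \<open>e\<close>; the condition on the integrals
bounds the relaxation norm of \<open>y - x\<close>.\<close>

definition relaxation_close :: "real \<Rightarrow> (real \<Rightarrow> 'x) \<Rightarrow> (real \<Rightarrow> 'z) \<Rightarrow> (real \<Rightarrow> 'x) \<Rightarrow> (real \<Rightarrow> 'z) \<Rightarrow> bool" where
  "relaxation_close e x z y w \<longleftrightarrow> norm (y \<tau> - x \<tau>) \<le> e \<and>
    (\<forall>t\<in>{0..\<tau>}. norm (w t - z t) \<le> e \<and> norm (integral {0..t} (\<lambda>s. y s - x s)) \<le> e)"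

lemma relaxation_close_refl: "e \<ge> 0 \<Longrightarrow> relaxation_close e x z x z"
  by (simp add: relaxation_close_def)

lemma relaxation_close_trans:
  assumes 1: "relaxation_close d x1 z1 x2 z2" and 2: "relaxation_close e x2 z2 x3 z3"
    and cont: "continuous_on {0..\<tau>} x1" "continuous_on {0..\<tau>} x2" "continuous_on {0..\<tau>} x3"
  shows "relaxation_close (d + e) x1 z1 x3 z3"
proof -
  have "norm (integral {0..t} (\<lambda>s. x3 s - x1 s)) \<le> d + e" if t: "t \<in> {0..\<tau>}" for t
  proof -
    have int: "x1 integrable_on {0..t}" "x2 integrable_on {0..t}" "x3 integrable_on {0..t}"
      using t by (auto intro!: integrable_continuous_real intro: continuous_on_subset[OF cont(1)]
          continuous_on_subset[OF cont(2)] continuous_on_subset[OF cont(3)])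
    have "integral {0..t} (\<lambda>s. x3 s - x1 s) = integral {0..t} (\<lambda>s. x2 s - x1 s) + integral {0..t} (\<lambda>s. x3 s - x2 s)"
      by (simp add: integral_diff int)
    also have "norm \<dots> \<le> d + e"
      using 1 2 t unfolding relaxation_close_def by (intro norm_triangle_mono) auto
    finally show ?thesis .
  qed
  moreover have "norm (z3 t - z1 t) \<le> d + e" if "t \<in> {0..\<tau>}" for t
  proof -
    have "norm ((z2 t - z1 t) + (z3 t - z2 t)) \<le> d + e"
      using 1 2 that unfolding relaxation_close_def by (intro norm_triangle_mono) auto
    then show ?thesis by simp
  qed
  moreover have "norm (x3 \<tau> - x1 \<tau>) \<le> d + e"
  proof -
    have "norm ((x2 \<tau> - x1 \<tau>) + (x3 \<tau> - x2 \<tau>)) \<le> d + e"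
      using 1 2 unfolding relaxation_close_def by (intro norm_triangle_mono) auto
    then show ?thesis by simp
  qed
  ultimately show ?thesis unfolding relaxation_close_def by blast
qed

text \<open>A uniform bound \<open>r\<close> that keeps both the pointwise and the integrated deviation below \<open>e / 2\<close>, and solutions
inside the tube of radius 1.\<close>

lemma small_radius_exists:
  assumes e: "e > 0"
  obtains r where "r > 0" "r \<le> 1" "r * \<tau> \<le> e / 2" "r \<le> e / 2"
proof -
  define r where "r = min 1 (e / (2 * (\<tau> + 1)))"
  have r: "r > 0" "r \<le> 1" using e \<tau> by (auto simp: r_def)
  have "r * (\<tau> + 1) \<le> e / (2 * (\<tau> + 1)) * (\<tau> + 1)"
    using \<tau> by (intro mult_right_mono) (auto simp: r_def)
  also have "\<dots> = e / 2" using \<tau> by (simp add: divide_simps)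
  finally have "r * \<tau> + r \<le> e / 2" by (simp add: distrib_left)
  moreover have "0 \<le> r * \<tau>" using r \<tau> by simp
  ultimately have "r * \<tau> \<le> e / 2" "r \<le> e / 2" using r(1) by linarith+
  with r show thesis by (rule that)
qed

text \<open>The heart of the proof. The curve \<open>v = y - \<zeta>\<close> with \<open>\<zeta> t = sqrt 2 sin (\<omega> t) \<xi> t\<close> is uniformly close to \<open>x\<close>
because \<open>(x, z)\<close> solves its equation up to terms that carry a factor \<open>sin (\<omega> t)\<close> or \<open>cos (2 \<omega> t)\<close>; the
factor \<open>sqrt 2\<close> gives the square of the oscillation the mean value 1, so that \<open>f \<zeta>\<close> averages to \<open>f \<xi>\<close>. The
price is the additional forcing \<open>\<eta> = \<zeta>'\<close>, which is large but has values where those of \<open>\<xi>\<close> are.\<close>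

lemma oscillation_replaces_quadratic_term:
  assumes g: "continuous_on {0..\<tau>} g" and \<xi>: "\<xi> \<in> smooth_curves E"
    and xz: "trajectory (\<lambda>t. g t - f (\<xi> t)) x z" and e: "e > 0"
  obtains \<eta> y w where "\<eta> \<in> smooth_curves E" "trajectory (\<lambda>t. g t + \<eta> t) y w" "relaxation_close e x z y w"
proof -
  note xc = trajectory_continuous[OF xz]
  have \<xi>c: "continuous_on {0..\<tau>} \<xi>"
    using C_infinity_on_imp_continuous[OF smooth_curves_C_infinity[OF \<xi>]] by (rule continuous_on_subset) simp
  have pc: "continuous_on {0..\<tau>} (\<lambda>t. (x t, z t))" by (intro continuous_intros xc)
  obtain M where M: "M \<ge> 0" "\<And>t. t \<in> {0..\<tau>} \<Longrightarrow> norm (x t, z t) \<le> M"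
    using continuous_on_Icc_bounded[OF pc] by blast
  obtain M' where M': "M' \<ge> 0" "\<And>t. t \<in> {0..\<tau>} \<Longrightarrow> norm (\<xi> t) \<le> M'"
    using continuous_on_Icc_bounded[OF \<xi>c] by blast
  \<comment> \<open>The oscillating factor is bounded by \<open>sqrt 2 \<le> 2\<close>.\<close>
  define R where "R = M + 2 * M'"
  have R: "R \<ge> 0" using M M' by (simp add: R_def)
  obtain L where L: "lipschitz_const (R + 1) L"
    using lipschitz_const_exists[of "R + 1"] R by auto
  obtain r where r: "r > 0" "r \<le> 1" and re: "r * \<tau> \<le> e / 2" "r \<le> e / 2"
    using small_radius_exists[OF e] .
  define \<delta> where "\<delta> = r / exp (L * \<tau>)"
  have \<delta>: "\<delta> > 0" "\<delta> * exp (L * \<tau>) = r" using r by (auto simp: \<delta>_def)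
  \<comment> \<open>The coefficients of \<open>sqrt 2 sin (\<omega> t)\<close> and of \<open>- cos (2 \<omega> t)\<close> in the defect, see \<open>vfield_diff\<close> below.\<close>
  define h1 where "h1 t = (A (\<xi> t) + 2 *\<^sub>R \<Gamma> (x t) (\<xi> t), \<Gamma>' (z t) (\<xi> t))" for t
  define h2 :: "real \<Rightarrow> 'x \<times> 'z" where "h2 t = (f (\<xi> t), 0)" for t
  have h1c: "continuous_on {0..\<tau>} h1" unfolding h1_def
    by (intro continuous_intros \<xi>c xc linear_continuous_on_compose[OF _ A]
        bilinear_continuous_on_compose[OF _ _ \<Gamma>] bilinear_continuous_on_compose[OF _ _ \<Gamma>'])
  have h2c: "continuous_on {0..\<tau>} h2" unfolding h2_def
    by (intro continuous_intros continuous_on_f \<xi>c)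
  have \<tau>0: "\<tau> \<ge> 0" using \<tau> by simp
  have half: "\<delta> / 2 > 0" "e / 2 > 0" using \<delta> e by auto
  obtain c1 where c1: "c1 > 0" "\<And>s S t. \<lbrakk>continuous_on {0..\<tau>} s; \<And>r. (S has_real_derivative s r) (at r);
        \<And>r. \<bar>s r\<bar> \<le> 2; \<And>r. \<bar>S r\<bar> \<le> c1; t \<in> {0..\<tau>}\<rbrakk> \<Longrightarrow> norm (integral {0..t} (\<lambda>r. s r *\<^sub>R h1 r)) \<le> \<delta> / 2"
    using oscillating_integral_small[OF \<tau>0 h1c half(1)] by blast
  obtain c2 where c2: "c2 > 0" "\<And>s S t. \<lbrakk>continuous_on {0..\<tau>} s; \<And>r. (S has_real_derivative s r) (at r);
        \<And>r. \<bar>s r\<bar> \<le> 2; \<And>r. \<bar>S r\<bar> \<le> c2; t \<in> {0..\<tau>}\<rbrakk> \<Longrightarrow> norm (integral {0..t} (\<lambda>r. s r *\<^sub>R h2 r)) \<le> \<delta> / 2"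
    using oscillating_integral_small[OF \<tau>0 h2c half(1)] by blast
  obtain c3 where c3: "c3 > 0" "\<And>s S t. \<lbrakk>continuous_on {0..\<tau>} s; \<And>r. (S has_real_derivative s r) (at r);
        \<And>r. \<bar>s r\<bar> \<le> 2; \<And>r. \<bar>S r\<bar> \<le> c3; t \<in> {0..\<tau>}\<rbrakk> \<Longrightarrow> norm (integral {0..t} (\<lambda>r. s r *\<^sub>R \<xi> r)) \<le> e / 2"
    using oscillating_integral_small[OF \<tau>0 \<xi>c half(2)] by blast
  define c where "c = min c1 (min c2 c3)"
  have c: "c > 0" "c \<le> c1" "c \<le> c2" "c \<le> c3" using c1 c2 c3 by (auto simp: c_def)
  \<comment> \<open>The antiderivatives of the oscillations are at most \<open>2 / \<omega>\<close>, and \<open>\<omega>\<close> is a multiple of \<open>pi / \<tau>\<close> so that \<open>\<zeta>\<close> vanishes at the final time.\<close>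
  obtain n :: nat where n: "real n > 2 * \<tau> / (c * pi)" using reals_Archimedean2 by blast
  define \<omega> where "\<omega> = real n * pi / \<tau>"
  have \<omega>: "2 / c < \<omega>" using n c \<tau> by (simp add: \<omega>_def field_simps)
  then have \<omega>0: "\<omega> > 0" using c(1) by (meson divide_pos_pos less_trans zero_less_numeral)
  have \<omega>c: "2 / \<omega> \<le> c" using \<omega> \<omega>0 c(1) by (simp add: field_simps)
  have \<omega>\<tau>: "\<omega> * \<tau> = real n * pi" using \<tau> by (simp add: \<omega>_def)
  define s where "s t = sqrt 2 * sin (\<omega> * t)" for t
  define S where "S t = - (sqrt 2 / \<omega>) * cos (\<omega> * t)" for t
  define k where "k t = cos (2 * \<omega> * t)" for t
  define K where "K t = sin (2 * \<omega> * t) / (2 * \<omega>)" for t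
  have sqrt2: "0 \<le> sqrt 2" "sqrt 2 \<le> (2::real)" by (auto intro: real_le_lsqrt)
  have sc: "continuous_on T s" and kc: "continuous_on T k" for T
    unfolding s_def k_def by (intro continuous_intros)+
  have S: "(S has_real_derivative s t) (at t)" and K: "(K has_real_derivative k t) (at t)" for t
    unfolding S_def s_def K_def k_def using \<omega>0 by (auto intro!: derivative_eq_intros)
  have s2: "\<bar>s t\<bar> \<le> 2" for t
    using mult_mono[OF sqrt2(2) abs_sin_le_one[of "\<omega> * t"]] by (simp add: s_def abs_mult)
  have k2: "\<bar>k t\<bar> \<le> 2" for t
    unfolding k_def by (rule order_trans[OF abs_cos_le_one]) simp
  have Sb: "\<bar>S t\<bar> \<le> c" for t
  proof -
    have "\<bar>S t\<bar> \<le> (2 / \<omega>) * 1"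
      unfolding S_def abs_mult using \<omega>0 sqrt2 by (intro mult_mono) (auto intro: divide_right_mono)
    with \<omega>c show ?thesis by simp
  qed
  have Kb: "\<bar>K t\<bar> \<le> c" for t
  proof -
    have "\<bar>K t\<bar> \<le> 1 / (2 * \<omega>)"
      unfolding K_def abs_divide using \<omega>0 by (auto intro!: divide_right_mono)
    also have "\<dots> \<le> 2 / \<omega>" using \<omega>0 by (simp add: field_simps)
    finally show ?thesis using \<omega>c by simp
  qed
  define \<zeta> where "\<zeta> t = s t *\<^sub>R \<xi> t" for t
  have \<zeta>c: "continuous_on {0..\<tau>} \<zeta>" unfolding \<zeta>_def by (intro continuous_intros sc \<xi>c)
  have "C_infinity_on UNIV s"
    using C_infinity_on_trig[of UNIV "sqrt 2" \<omega> 0] by (simp add: s_def[abs_def])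
  from smooth_curves_scaleR[OF this \<xi>] have "\<zeta> \<in> smooth_curves E" by (simp add: \<zeta>_def[abs_def])
  then obtain \<eta> where \<eta>: "\<eta> \<in> smooth_curves E" "\<And>t. (\<zeta> has_vector_derivative \<eta> t) (at t)"
    using smooth_curves_derivative by blast
  have \<zeta>R: "norm (\<zeta> t) \<le> R" if "t \<in> {0..\<tau>}" for t
    using mult_mono[OF s2[of t] M'(2)[OF that]] M(1) by (simp add: \<zeta>_def R_def)
  have pR: "norm (x t, z t) \<le> R" if "t \<in> {0..\<tau>}" for t
    using M(2)[OF that] M'(1) by (simp add: R_def)
  have vfield_diff: "vfield (\<lambda>t. g t - f (\<xi> t)) (\<lambda>_. 0) t (x t, z t) - vfield g \<zeta> t (x t, z t)
      = s t *\<^sub>R h1 t - k t *\<^sub>R h2 t" for t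
  proof -
    have sq: "s t * s t = 1 - k t"
      using cos_double_sin[of "\<omega> * t"] by (simp add: s_def k_def power2_eq_square mult_ac)
    have "f (x t + \<zeta> t) = f (x t) + (s t *\<^sub>R \<Gamma> (x t) (\<xi> t) + s t *\<^sub>R \<Gamma> (x t) (\<xi> t)) + (s t * s t) *\<^sub>R f (\<xi> t)"
      using \<Gamma>_sym[of "\<xi> t" "x t"]
      by (simp add: f \<zeta>_def bilinear_ladd[OF \<Gamma>] bilinear_radd[OF \<Gamma>] bilinear_lmul[OF \<Gamma>]
          bilinear_rmul[OF \<Gamma>] algebra_simps)
    then show ?thesis
      by (simp add: vfield_def h1_def h2_def sq \<zeta>_def linear_add[OF A] linear_cmul[OF A]
          bilinear_radd[OF \<Gamma>'] bilinear_rmul[OF \<Gamma>'] scaleR_2 algebra_simps)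
  qed
  have defect: "norm ((x t, z t) - (x 0, z 0) - integral {0..t} (\<lambda>s. vfield g \<zeta> s (x s, z s))) \<le> \<delta>"
    if t: "t \<in> {0..\<tau>}" for t
  proof -
    have sub: "continuous_on {0..t} h" if "continuous_on {0..\<tau>} h" for h :: "real \<Rightarrow> 'x \<times> 'z"
      by (rule continuous_on_subset[OF that]) (use t in auto)
    have int: "(\<lambda>r. s r *\<^sub>R h1 r) integrable_on {0..t}" "(\<lambda>r. k r *\<^sub>R h2 r) integrable_on {0..t}"
      by (intro integrable_continuous_real continuous_intros sub sc kc h1c h2c)+
    have int2: "(\<lambda>s. vfield g \<zeta> s (x s, z s)) integrable_on {0..t}"
      by (intro integrable_continuous_real sub vfield_continuous g \<zeta>c pc)
    have "(x t, z t) - (x 0, z 0) = integral {0..t} (\<lambda>s. vfield (\<lambda>t. g t - f (\<xi> t)) (\<lambda>_. 0) s (x s, z s))"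
      using integral_unique[OF trajectory_integral[OF xz t]] xz by (simp add: trajectory_vfield)
    then have "(x t, z t) - (x 0, z 0) - integral {0..t} (\<lambda>s. vfield g \<zeta> s (x s, z s))
        = integral {0..t} (\<lambda>s. vfield (\<lambda>t. g t - f (\<xi> t)) (\<lambda>_. 0) s (x s, z s) - vfield g \<zeta> s (x s, z s))"
      using integral_diff[OF has_integral_integrable[OF trajectory_integral[OF xz t]] int2] by simp
    also have "\<dots> = integral {0..t} (\<lambda>r. s r *\<^sub>R h1 r) - integral {0..t} (\<lambda>r. k r *\<^sub>R h2 r)"
      unfolding vfield_diff by (rule integral_diff[OF int])
    also have "norm \<dots> \<le> \<delta> / 2 + \<delta> / 2"
    proof (rule order_trans[OF norm_triangle_ineq4 add_mono])
      show "norm (integral {0..t} (\<lambda>r. s r *\<^sub>R h1 r)) \<le> \<delta> / 2"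
        by (rule c1(2)[OF sc S s2 order_trans[OF Sb c(2)] t])
      show "norm (integral {0..t} (\<lambda>r. k r *\<^sub>R h2 r)) \<le> \<delta> / 2"
        by (rule c2(2)[OF kc K k2 order_trans[OF Kb c(3)] t])
    qed
    finally show ?thesis by simp
  qed
  obtain v w where vw0: "v 0 = x 0" "w 0 = z 0"
    and v: "\<And>t. t \<in> {0..\<tau>} \<Longrightarrow> (v has_vector_derivative g t - A (v t + \<zeta> t) - f (v t + \<zeta> t)) (at t within {0..\<tau>})"
    and w: "\<And>t. t \<in> {0..\<tau>} \<Longrightarrow> (w has_vector_derivative - \<Gamma>' (w t) (v t + \<zeta> t) - F (w t)) (at t within {0..\<tau>})"
    and near: "\<And>t. t \<in> {0..\<tau>} \<Longrightarrow> norm (v t - x t) \<le> r" "\<And>t. t \<in> {0..\<tau>} \<Longrightarrow> norm (w t - z t) \<le> r"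
    using oscillating_solution_near_approximate_solution[OF L g \<zeta>c xc \<zeta>R pR defect]
    unfolding \<delta>(2) using r(2) by blast
  have vc: "continuous_on {0..\<tau>} v"
    unfolding continuous_on_eq_continuous_within by (intro ballI has_vector_derivative_continuous[OF v])
  have "trajectory (\<lambda>t. g t + \<eta> t) (\<lambda>t. v t + \<zeta> t) w"
    unfolding solves_coupled_system_def
  proof (intro conjI ballI)
    show "v 0 + \<zeta> 0 = x0" "w 0 = z0"
      using vw0 xz by (auto simp: \<zeta>_def s_def trajectory_vfield)
    fix t assume t: "t \<in> {0..\<tau>}"
    show "(w has_vector_derivative - \<Gamma>' (w t) (v t + \<zeta> t) - F (w t)) (at t within {0..\<tau>})" by (rule w[OF t])
    have "((\<lambda>t. v t + \<zeta> t) has_vector_derivative (g t - A (v t + \<zeta> t) - f (v t + \<zeta> t)) + \<eta> t) (at t within {0..\<tau>})"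
      by (intro has_vector_derivative_add v t has_vector_derivative_at_within[OF \<eta>(2)])
    then show "((\<lambda>t. v t + \<zeta> t) has_vector_derivative g t + \<eta> t - A (v t + \<zeta> t) - f (v t + \<zeta> t)) (at t within {0..\<tau>})"
      by (simp add: algebra_simps)
  qed
  moreover have "relaxation_close e x z (\<lambda>t. v t + \<zeta> t) w"
    unfolding relaxation_close_def
  proof (intro conjI ballI)
    have "\<zeta> \<tau> = 0" by (simp add: \<zeta>_def s_def \<omega>\<tau>)
    then show "norm (v \<tau> + \<zeta> \<tau> - x \<tau>) \<le> e" using near(1)[of \<tau>] re(2) e \<tau> by simp
    fix t assume t: "t \<in> {0..\<tau>}"
    show "norm (w t - z t) \<le> e" using near(2)[OF t] re(2) e by simp
    have int: "(\<lambda>s. v s - x s) integrable_on {0..t}" "\<zeta> integrable_on {0..t}"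
      using t by (auto intro!: integrable_continuous_real continuous_on_diff continuous_on_subset[OF vc]
          continuous_on_subset[OF xc(1)] continuous_on_subset[OF \<zeta>c])
    have "integral {0..t} (\<lambda>s. v s + \<zeta> s - x s) = integral {0..t} (\<lambda>s. v s - x s) + integral {0..t} \<zeta>"
      using Henstock_Kurzweil_Integration.integral_add[OF int] by (simp add: algebra_simps)
    also have "norm \<dots> \<le> e / 2 + e / 2"
    proof (rule norm_triangle_mono)
      show "norm (integral {0..t} (\<lambda>s. v s - x s)) \<le> e / 2"
        using norm_integral_le_sup[OF continuous_on_diff[OF vc xc(1)] near(1) t] re(1) by linarith
      show "norm (integral {0..t} \<zeta>) \<le> e / 2"
        unfolding \<zeta>_def by (rule c3(2)[OF sc S s2 order_trans[OF Sb c(4)] t])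
    qed
    finally show "norm (integral {0..t} (\<lambda>s. v s + \<zeta> s - x s)) \<le> e" by simp
  qed
  ultimately show thesis using \<eta>(1) that by blast
qed

section \<open>Descent through the saturating spaces\<close>

lemma relaxed_forcings_continuous:
  "h \<in> relaxed_forcings f E \<Longrightarrow> continuous_on S h"
proof (induction rule: relaxed_forcings.induct)
  case (base h)
  show ?case
    using C_infinity_on_imp_continuous[OF smooth_curves_C_infinity[OF base]] by (rule continuous_on_subset) simp
next
  case (step h \<xi>)
  have "continuous_on S \<xi>"
    using C_infinity_on_imp_continuous[OF smooth_curves_C_infinity[OF step(2)]] by (rule continuous_on_subset) simp
  then show ?case by (intro continuous_on_diff step continuous_on_f)
qed

text \<open>Each oscillation adds a forcing \<open>\<eta>\<close> to the terms that are still to be treated. The additional smooth forcing \<open>k\<close> in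
the statement makes room for it in the induction.\<close>

lemma relaxed_forcing_trajectory_approx:
  assumes "h \<in> relaxed_forcings f E" "k \<in> smooth_curves E" "trajectory (\<lambda>t. h t + k t) x z" "e > 0"
  shows "\<exists>g\<in>smooth_curves E. \<exists>y w. trajectory g y w \<and> relaxation_close e x z y w"
  using assms
proof (induction arbitrary: k x z e rule: relaxed_forcings.induct)
  case (base h)
  then show ?case
    by (intro bexI[of _ "\<lambda>t. h t + k t"] exI[of _ x] exI[of _ z] conjI relaxation_close_refl smooth_curves_add) auto
next
  case (step h \<xi>)
  have "(\<lambda>t. h t + k t) \<in> relaxed_forcings f E"
    by (rule relaxed_forcings_add[OF step(1) relaxed_forcings.base[OF step(4)]])
  then have "continuous_on {0..\<tau>} (\<lambda>t. h t + k t)" by (rule relaxed_forcings_continuous)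
  moreover have xz: "trajectory (\<lambda>t. (h t + k t) - f (\<xi> t)) x z"
    using step(5) by (simp add: algebra_simps)
  moreover have e: "e / 2 > 0" using step(6) by simp
  ultimately obtain \<eta> y w where \<eta>: "\<eta> \<in> smooth_curves E" and yw: "trajectory (\<lambda>t. (h t + k t) + \<eta> t) y w"
    and close: "relaxation_close (e / 2) x z y w"
    using oscillation_replaces_quadratic_term[OF _ step(2)] by blast
  have "trajectory (\<lambda>t. h t + (k t + \<eta> t)) y w" using yw by (simp add: add.assoc)
  then obtain g y' w' where g: "g \<in> smooth_curves E" and yw': "trajectory g y' w'"
    and close': "relaxation_close (e / 2) y w y' w'"
    using step(3)[OF smooth_curves_add[OF step(4) \<eta>] _ e] by blast
  have "relaxation_close (e / 2 + e / 2) x z y' w'"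
    by (rule relaxation_close_trans[OF close close' trajectory_continuous(1)[OF xz]
          trajectory_continuous(1)[OF yw] trajectory_continuous(1)[OF yw']])
  then show ?case using g yw' by auto
qed

lemma subspace_saturating_space: "linear B \<Longrightarrow> subspace (saturating_space f B n)"
  by (induction n) (auto simp: linear_subspace_image intro: subspace_saturate[OF _ \<Gamma> f])

lemma saturated_forcing_trajectory_approx:
  assumes B: "linear B" and "h \<in> smooth_curves (saturating_space f B n)" "trajectory h x z" "e > 0"
  shows "\<exists>g\<in>smooth_curves (range B). \<exists>y w. trajectory g y w \<and> relaxation_close e x z y w"
  using assms(2-)
proof (induction n arbitrary: h x z e)
  case 0
  then show ?case using relaxation_close_refl[of e x z] by auto
next
  case (Suc n)
  note sub = subspace_saturating_space[OF B, of n]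
  have e: "e / 2 > 0" using Suc.prems by simp
  have "h \<in> relaxed_forcings f (saturating_space f B n)"
    using smooth_curves_saturate_relaxed_forcings[OF sub \<Gamma> f] Suc.prems(1) by simp
  then obtain g y w where g: "g \<in> smooth_curves (saturating_space f B n)" and yw: "trajectory g y w"
    and close: "relaxation_close (e / 2) x z y w"
    using relaxed_forcing_trajectory_approx[OF _ smooth_curves_zero _ e, of h "saturating_space f B n" x z] Suc.prems(2)
    by auto
  obtain g' y' w' where g': "g' \<in> smooth_curves (range B)" and yw': "trajectory g' y' w'"
    and close': "relaxation_close (e / 2) y w y' w'"
    using Suc.IH[OF g yw e] by blast
  have "relaxation_close (e / 2 + e / 2) x z y' w'"
    by (rule relaxation_close_trans[OF close close' trajectory_continuous(1)[OF Suc.prems(2)]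
          trajectory_continuous(1)[OF yw] trajectory_continuous(1)[OF yw']])
  then show ?case using g' yw' by auto
qed

text \<open>Any smooth \<open>x\<close> solves the first equation exactly for the forcing \<open>x' + A x + f x\<close>. If \<open>x\<close> is close to
\<open>xbar\<close>, then \<open>(x, zbar)\<close> is an approximate solution of the whole system, with a defect in the second
component only.\<close>

lemma smooth_trajectory_near_target:
  assumes xbar: "continuous_on {0..\<tau>} xbar" "xbar 0 = x0"
    and zbar: "continuous_on {0..\<tau>} zbar"
      "\<And>t. t \<in> {0..\<tau>} \<Longrightarrow> zbar t = z0 + integral {0..t} (\<lambda>s. - \<Gamma>' (zbar s) (xbar s) - F (zbar s))"
    and e: "e > 0"
  shows "\<exists>h\<in>smooth_curves UNIV. \<exists>x z. trajectory h x z \<and> relaxation_close e xbar zbar x z"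
proof -
  obtain M where M: "M \<ge> 0" "\<And>t. t \<in> {0..\<tau>} \<Longrightarrow> norm (xbar t) \<le> M"
    using continuous_on_Icc_bounded[OF xbar(1)] by blast
  obtain M' where M': "M' \<ge> 0" "\<And>t. t \<in> {0..\<tau>} \<Longrightarrow> norm (zbar t) \<le> M'"
    using continuous_on_Icc_bounded[OF zbar(1)] by blast
  define R where "R = M + 1 + M'"
  have R: "R \<ge> 0" using M M' by (simp add: R_def)
  obtain L where L: "lipschitz_const (R + 1) L"
    using lipschitz_const_exists[of "R + 1"] R by auto
  obtain b where b: "b > 0" "\<And>x y. norm (\<Gamma>' x y) \<le> b * norm x * norm y"
    using bilinear_bounded_pos[OF \<Gamma>'] by blast
  obtain r where r: "r > 0" "r \<le> 1" and re: "r * \<tau> \<le> e / 2" "r \<le> e / 2"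
    using small_radius_exists[OF e] .
  define \<delta> where "\<delta> = r / exp (L * \<tau>)"
  have \<delta>: "\<delta> > 0" "\<delta> * exp (L * \<tau>) = r" using r by (auto simp: \<delta>_def)
  define Q where "Q = b * M' * \<tau> + 1"
  have Q: "Q > 0" using b M' \<tau> by (simp add: Q_def add_nonneg_pos)
  define d where "d = min r (\<delta> / Q)"
  have d: "d > 0" "d \<le> r" "d \<le> 1" "b * M' * d * \<tau> \<le> \<delta>"
  proof -
    show d: "d > 0" "d \<le> r" "d \<le> 1" using r \<delta> Q by (auto simp: d_def)
    have "b * M' * d * \<tau> \<le> Q * d" using d by (simp add: Q_def algebra_simps)
    also have "\<dots> \<le> Q * (\<delta> / Q)" using Q by (intro mult_left_mono) (auto simp: d_def)
    finally show "b * M' * d * \<tau> \<le> \<delta>" using Q by simp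
  qed
  obtain q where q: "polynomial_function q" "\<And>t. t \<in> {0..\<tau>} \<Longrightarrow> norm (xbar t - q t) < d / 2"
    using Stone_Weierstrass_polynomial_function[OF _ xbar(1), of "d / 2"] d by auto
  \<comment> \<open>Only the initial value has to be matched exactly, so a constant correction suffices.\<close>
  define x where "x t = q t + (xbar 0 - q 0)" for t
  have "polynomial_function x" unfolding x_def[abs_def]
    by (intro polynomial_function_add q polynomial_function_const)
  then have x: "x \<in> smooth_curves UNIV" by (rule polynomial_function_smooth_curves)
  have x_near: "norm (x t - xbar t) \<le> d" if t: "t \<in> {0..\<tau>}" for t
  proof -
    have "x t - xbar t = (xbar 0 - q 0) - (xbar t - q t)" by (simp add: x_def)
    also have "norm \<dots> \<le> d / 2 + d / 2"
      using q(2)[OF t] q(2)[of 0] \<tau> by (intro order_trans[OF norm_triangle_ineq4 add_mono]) simp_all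
    finally show ?thesis by simp
  qed
  obtain x' where x': "x' \<in> smooth_curves UNIV" "\<And>t. (x has_vector_derivative x' t) (at t)"
    using smooth_curves_derivative[OF x] by blast
  define h where "h t = x' t + (A (x t) + f (x t))" for t
  have h: "h \<in> smooth_curves UNIV"
    unfolding h_def[abs_def] f
    by (intro smooth_curves_add x' smooth_curves_bilinear[OF \<Gamma>] x
        smooth_curves_mono[OF smooth_curves_linear_image[OF A x] subset_UNIV])
  have smooth_cont: "continuous_on {0..\<tau>} k" if "k \<in> smooth_curves UNIV" for k :: "real \<Rightarrow> 'x"
    using C_infinity_on_imp_continuous[OF smooth_curves_C_infinity[OF that]] by (rule continuous_on_subset) simp
  have pR: "norm (x t, zbar t) \<le> R" if t: "t \<in> {0..\<tau>}" for t
  proof -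
    have "norm (xbar t + (x t - xbar t)) \<le> M + 1"
      using M(2)[OF t] x_near[OF t] d(3) by (intro norm_triangle_mono) auto
    then show ?thesis using norm_Pair_le[of "x t" "zbar t"] M'(2)[OF t] by (simp add: R_def)
  qed
  have defect: "norm ((x t, zbar t) - (x 0, zbar 0) - integral {0..t} (\<lambda>s. vfield h (\<lambda>_. 0) s (x s, zbar s))) \<le> \<delta>"
    if t: "t \<in> {0..\<tau>}" for t
  proof -
    let ?v = "\<lambda>s. - \<Gamma>' (zbar s) (xbar s) - F (zbar s)" and ?w = "\<lambda>s. - \<Gamma>' (zbar s) (x s) - F (zbar s)"
    have vc: "continuous_on {0..\<tau>} ?v" "continuous_on {0..\<tau>} ?w"
      by (intro continuous_intros continuous_on_F zbar(1) xbar(1) smooth_cont[OF x]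
          bilinear_continuous_on_compose[OF _ _ \<Gamma>'])+
    have int: "?v integrable_on {0..t}" "?w integrable_on {0..t}"
      using t by (auto intro!: integrable_continuous_real continuous_on_subset[OF vc(1)] continuous_on_subset[OF vc(2)])
    have "((\<lambda>s. (x' s, ?w s)) has_integral (x t, integral {0..t} ?w) - (x 0, integral {0..0} ?w)) {0..t}"
    proof (rule fundamental_theorem_of_calculus)
      fix s assume s: "s \<in> {0..t}"
      have "((\<lambda>s. integral {0..s} ?w) has_vector_derivative ?w s) (at s within {0..t})"
        using integral_has_vector_derivative[OF vc(2), of s] s t
        by (auto intro: has_vector_derivative_within_subset)
      then show "((\<lambda>s. (x s, integral {0..s} ?w)) has_vector_derivative (x' s, ?w s)) (at s within {0..t})"
        by (intro has_vector_derivative_Pair has_vector_derivative_at_within[OF x'(2)])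
    qed (use t in simp)
    then have "((\<lambda>s. (x' s, ?w s)) has_integral (x t - x 0, integral {0..t} ?w)) {0..t}" by simp
    moreover have "vfield h (\<lambda>_. 0) s (x s, zbar s) = (x' s, ?w s)" for s by (simp add: vfield_def h_def)
    ultimately have "integral {0..t} (\<lambda>s. vfield h (\<lambda>_. 0) s (x s, zbar s)) = (x t - x 0, integral {0..t} ?w)"
      by (simp add: integral_unique)
    moreover have "zbar t - zbar 0 = integral {0..t} ?v" using zbar(2)[OF t] zbar(2)[of 0] \<tau> by simp
    ultimately have "(x t, zbar t) - (x 0, zbar 0) - integral {0..t} (\<lambda>s. vfield h (\<lambda>_. 0) s (x s, zbar s))
        = (0, integral {0..t} ?v - integral {0..t} ?w)" by simp
    also have "integral {0..t} ?v - integral {0..t} ?w = integral {0..t} (\<lambda>s. ?v s - ?w s)"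
      by (simp only: integral_diff int)
    also have "norm (0 :: 'x, integral {0..t} (\<lambda>s. ?v s - ?w s)) \<le> b * M' * d * \<tau>"
    proof -
      have "norm (integral {0..t} (\<lambda>s. ?v s - ?w s)) \<le> b * M' * d * \<tau>"
      proof (rule norm_integral_le_sup[OF continuous_on_diff[OF vc] _ t])
        fix s assume s: "s \<in> {0..\<tau>}"
        have "?v s - ?w s = \<Gamma>' (zbar s) (x s - xbar s)" by (simp add: bilinear_rsub[OF \<Gamma>'])
        then show "norm (?v s - ?w s) \<le> b * M' * d"
          using b M'(1) M'(2)[OF s] x_near[OF s]
          by (auto intro!: order_trans[OF b(2)] mult_mono mult_nonneg_nonneg)
      qed
      then show ?thesis by (simp add: norm_Pair)
    qed
    finally show ?thesis using d(4) by simp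
  qed
  obtain v w where vw0: "v 0 = x 0" "w 0 = zbar 0"
    and v: "\<And>t. t \<in> {0..\<tau>} \<Longrightarrow> (v has_vector_derivative h t - A (v t) - f (v t)) (at t within {0..\<tau>})"
    and w: "\<And>t. t \<in> {0..\<tau>} \<Longrightarrow> (w has_vector_derivative - \<Gamma>' (w t) (v t) - F (w t)) (at t within {0..\<tau>})"
    and near: "\<And>t. t \<in> {0..\<tau>} \<Longrightarrow> norm (v t - x t) \<le> r" "\<And>t. t \<in> {0..\<tau>} \<Longrightarrow> norm (w t - zbar t) \<le> r"
    using oscillating_solution_near_approximate_solution[OF L smooth_cont[OF h] continuous_on_const
        smooth_cont[OF x] zbar(1) _ pR defect]
    unfolding \<delta>(2) norm_zero add_0_right using R r(2) by blast
  have vc: "continuous_on {0..\<tau>} v"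
    unfolding continuous_on_eq_continuous_within by (intro ballI has_vector_derivative_continuous[OF v])
  have "trajectory h v w"
    unfolding solves_coupled_system_def using vw0 v w xbar(2) zbar(2)[of 0] \<tau> by (simp add: x_def)
  moreover have "relaxation_close e xbar zbar v w"
    unfolding relaxation_close_def
  proof (intro conjI ballI)
    have vx: "norm (v t - xbar t) \<le> 2 * r" if t: "t \<in> {0..\<tau>}" for t
    proof -
      have "norm ((v t - x t) + (x t - xbar t)) \<le> r + r"
        using near(1)[OF t] x_near[OF t] d(2) by (intro norm_triangle_mono) auto
      then show ?thesis by simp
    qed
    show "norm (v \<tau> - xbar \<tau>) \<le> e" using vx[of \<tau>] \<tau> re(2) by simp
    fix t assume t: "t \<in> {0..\<tau>}"
    show "norm (w t - zbar t) \<le> e" using near(2)[OF t] re(2) e by simp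
    show "norm (integral {0..t} (\<lambda>s. v s - xbar s)) \<le> e"
      using norm_integral_le_sup[OF continuous_on_diff[OF vc xbar(1)] vx t] re(1) by simp
  qed
  ultimately show ?thesis using h by blast
qed

end

section \<open>Approximate controllability\<close>

theorem theorem7p1:
  fixes A :: "'x::euclidean_space \<Rightarrow> 'x"
    and B :: "'u::euclidean_space \<Rightarrow> 'x"
    and f :: "'x \<Rightarrow> 'x"
    and \<Gamma> :: "'x \<Rightarrow> 'x \<Rightarrow> 'x"
    and \<Gamma>' :: "'z::euclidean_space \<Rightarrow> 'x \<Rightarrow> 'z"
    and F :: "'z \<Rightarrow> 'z"
    and \<tau> \<epsilon> :: real
    and x0 :: 'x and z0 :: 'z
    and xbar :: "real \<Rightarrow> 'x" and zbar dzbar :: "real \<Rightarrow> 'z"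
    and n\<^sub>X :: nat
  assumes "linear A" and "linear B"
    and "bilinear \<Gamma>" and "\<And>x y. \<Gamma> x y = \<Gamma> y x" and "\<And>x. f x = \<Gamma> x x"
    and "bilinear \<Gamma>'"
    and "local_lipschitz (UNIV :: real set) UNIV (\<lambda>_. F)"
    and "\<tau> > 0"
    and "sobolev_W12 \<tau> zbar" and "continuous_on {0..\<tau>} zbar"
    and "continuous_on {0..\<tau>} xbar"
    and "zbar 0 = z0" and "xbar 0 = x0"
    and "has_weak_derivative \<tau> zbar dzbar"
    and "AE t in lebesgue_on {0<..<\<tau>}. dzbar t + \<Gamma>' (zbar t) (xbar t) + F (zbar t) = 0"
    and "saturating_space f B n\<^sub>X = UNIV"
    and "\<epsilon> > 0"
  shows "\<exists>u :: real \<Rightarrow> 'u. C_infinity_on {0..\<tau>} u \<and>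
           (\<exists>x z. solves_coupled_system \<tau> A f B \<Gamma>' F x0 z0 u x z) \<and>
           (\<forall>x z. solves_coupled_system \<tau> A f B \<Gamma>' F x0 z0 u x z \<longrightarrow>
              (SUP t\<in>{0..\<tau>}. norm (z t - zbar t)) + norm (x \<tau> - xbar \<tau>)
                + relaxation_norm \<tau> (\<lambda>t. x t - xbar t) < \<epsilon>)"
proof -
  interpret coupled_system A f \<Gamma> \<Gamma>' F \<tau> x0 z0
    by (intro coupled_system.intro assms)
  let ?h = "\<lambda>s. - \<Gamma>' (zbar s) (xbar s) - F (zbar s)"
  have h: "continuous_on {0..\<tau>} ?h"
    by (intro continuous_intros continuous_on_F assms bilinear_continuous_on_compose[OF _ _ \<open>bilinear \<Gamma>'\<close>])
  have "AE t in lebesgue_on {0<..<\<tau>}. dzbar t = ?h t"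
    using assms(15) by (rule eventually_mono) (simp add: algebra_simps eq_neg_iff_add_eq_0)
  then have zbar: "zbar t = z0 + integral {0..t} ?h" if "t \<in> {0..\<tau>}" for t
    using du_Bois_Reymond[OF \<open>\<tau> > 0\<close> \<open>continuous_on {0..\<tau>} zbar\<close> h
        \<open>has_weak_derivative \<tau> zbar dzbar\<close> _ that] \<open>zbar 0 = z0\<close> by simp
  \<comment> \<open>Two approximation steps bound each of the three summands by \<open>2 e = \<epsilon> / 4\<close>.\<close>
  define e where "e = \<epsilon> / 8"
  have e: "e > 0" using \<open>\<epsilon> > 0\<close> by (simp add: e_def)
  obtain k x1 z1 where k: "k \<in> smooth_curves UNIV" and 1: "trajectory k x1 z1"
    and close1: "relaxation_close e xbar zbar x1 z1"
    using smooth_trajectory_near_target[OF \<open>continuous_on {0..\<tau>} xbar\<close> \<open>xbar 0 = x0\<close>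
        \<open>continuous_on {0..\<tau>} zbar\<close> zbar e] by blast
  have "k \<in> smooth_curves (saturating_space f B n\<^sub>X)" using k assms(16) by simp
  then obtain g x2 z2 where g: "g \<in> smooth_curves (range B)" and 2: "trajectory g x2 z2"
    and close2: "relaxation_close e x1 z1 x2 z2"
    using saturated_forcing_trajectory_approx[OF \<open>linear B\<close> _ 1 e] by blast
  have close: "relaxation_close (e + e) xbar zbar x2 z2"
    by (rule relaxation_close_trans[OF close1 close2 \<open>continuous_on {0..\<tau>} xbar\<close>
          trajectory_continuous(1)[OF 1] trajectory_continuous(1)[OF 2]])
  obtain u where u: "u \<in> smooth_curves UNIV" "\<And>t. B (u t) = g t"
    using smooth_curves_lift[OF \<open>linear B\<close> g] by blast
  have sol_iff: "solves_coupled_system \<tau> A f B \<Gamma>' F x0 z0 u x z \<longleftrightarrow> trajectory g x z" for x z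
    unfolding solves_coupled_system_def u(2) ..
  show ?thesis
  proof (intro exI[of _ u] conjI allI impI)
    show "C_infinity_on {0..\<tau>} u"
      using smooth_curves_C_infinity[OF u(1)] by (rule C_infinity_on_subset) simp
    show "\<exists>x z. solves_coupled_system \<tau> A f B \<Gamma>' F x0 z0 u x z" using 2 sol_iff by blast
    fix x z assume "solves_coupled_system \<tau> A f B \<Gamma>' F x0 z0 u x z"
    then have "trajectory g x z" by (simp add: sol_iff)
    then have eq: "x t = x2 t" "z t = z2 t" if "t \<in> {0..\<tau>}" for t
      using trajectory_unique[OF _ 2 that] by blast+
    have "(SUP t\<in>{0..\<tau>}. norm (z t - zbar t)) \<le> e + e"
      using close \<tau> eq unfolding relaxation_close_def by (intro cSUP_least) auto
    moreover have "norm (x \<tau> - xbar \<tau>) \<le> e + e"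
      using close \<tau> eq(1)[of \<tau>] unfolding relaxation_close_def by simp
    moreover have "relaxation_norm \<tau> (\<lambda>t. x t - xbar t) \<le> e + e"
      unfolding relaxation_norm_def
    proof (rule cSUP_least)
      fix t assume t: "t \<in> {0..\<tau>}"
      have "integral {0..t} (\<lambda>s. x s - xbar s) = integral {0..t} (\<lambda>s. x2 s - xbar s)"
        by (rule Henstock_Kurzweil_Integration.integral_cong) (use t eq(1) in auto)
      then show "norm (integral {0..t} (\<lambda>s. x s - xbar s)) \<le> e + e"
        using close t unfolding relaxation_close_def by simp
    qed (use \<tau> in simp)
    ultimately show "(SUP t\<in>{0..\<tau>}. norm (z t - zbar t)) + norm (x \<tau> - xbar \<tau>)
        + relaxation_norm \<tau> (\<lambda>t. x t - xbar t) < \<epsilon>"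
      using \<open>\<epsilon> > 0\<close> unfolding e_def by linarith
  qed
qed

end
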